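(* Let $F$, $G$, $H$ be homogeneous integral functionals over the infinite jet superspace, of gradings $|F|$, $|G|$, $|H|$. Then each of the following three (tautologically equivalent) statements is valid. (i) The noncommutative variational Schouten bracket satisfies the shifted-graded Jacobi identity $$(-1)^{(|F|-1)(|H|-1)}[\![F,[\![G,H]\!]]\!]+(-1)^{(|F|-1)(|G|-1)}[\![G,[\![H,F]\!]]\!]+(-1)^{(|G|-1)(|H|-1)}[\![H,[\![F,G]\!]]\!]=0.$$ (ii) The graded Leibniz rule holds for the operator $[\![F,\cdot]\!]$ acting on $[\![G,H]\!]$: $$[\![F,[\![G,H]\!]]\!]=[\![[\![F,G]\!],H]\!]+(-1)^{(|F|-1)(|G|-1)}[\![G,[\![F,H]\!]]\!].$$ (iii) The graded commutator of the operators $[\![F,\cdot]\!]$ and $[\![G,\cdot]\!]$ is equal to the operator $[\![[\![F,G]\!],\cdot]\!]$: $$[\![F,[\![G,\cdot]\!]]\!](H)-(-1)^{(|F|-1)(|G|-1)}[\![G,[\![F,\cdot]\!]]\!](H)=[\![[\![F,G]\!],\cdot]\!](H).$$ Here the arrangement of parentheses in the product of the three functionals, in which the identity (iii) is evaluated, is $(F\times G)\times H$; both variants (i) and (ii) are obtained from (iii) by multiplication by sign factors.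
   Context: **Letters and cyclic words.** The ground field is $\mathbb{R}$. $M^n$ is an oriented affine real manifold of dimension $n$, with local affine coordinates $x=(x^1,\dots,x^n)$ and a volume element $\mathrm{dvol}(x)$. The alphabet consists of even letters $a^i_\sigma$ (degree $0$) and odd letters $b_{j,\tau}$ (degree $1$), $1\le i,j\le m$, where $\sigma,\tau$ are multi-indices ($a^i=a^i_\varnothing$, $b_j=b_{j,\varnothing}$); $[a],[b]$ denote dependence on finitely many of these jet letters. The degree $|w|$ of a word is the number of its odd letters. A cyclic word $(w)$ is the class of an element $w$ of the free associative algebra on these letters (with coefficients in $C^\infty(M^n)$) modulo the linear relation $w\sim\mathfrak{t}(w)$, $\mathfrak{t}(\gamma_1\cdots\gamma_\lambda)=(-1)^{|\gamma_1\cdots\gamma_{\lambda-1}|\cdot|\gamma_\lambda|}\gamma_\lambda\gamma_1\cdots\gamma_{\lambda-1}$. For words of lengths $\lambda(w_1),\lambda(w_2)>0$ put $$(w_1)\times(w_2)=\frac{1}{\lambda(w_1)\lambda(w_2)}\sum_{i=1}^{\lambda(w_1)}\sum_{j=1}^{\lambda(w_2)}\bigl(\mathfrak{t}^{i-1}(w_1)\,\mathfrak{t}^{j-1}(w_2)\bigr),$$ extended bilinearly, zero-length words being scalars acting by multiplication. This product is graded commutative and not associative. The total derivative $D_{x^k}$ is the derivation equal to $\partial/\partial x^k$ on coefficients with $a^i_\sigma\mapsto a^i_{\sigma\cup\{k\}}$, $b_{j,\tau}\mapsto b_{j,\tau\cup\{k\}}$. **Functionals.** An integral functional is $F=\int f(x,[a],[b])\,\mathrm{dvol}(x)$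 with $f$ a (sum of) cyclic word(s), modulo integration by parts without boundary terms (coefficients are smooth and, if $M^n$ is not closed, decay rapidly towards the boundary or infinity). The product of $F_1,F_2$ is $F_1\times F_2=\iint f_1|_{x_1}\times f_2|_{x_2}\,\mathrm{dvol}(x_1)\mathrm{dvol}(x_2)$ over $M^n\times M^n$. Local functionals are linear combinations of products of $\ell\ge0$ integral functionals (with a specified bracketing; default $(\cdots(F_1\times F_2)\times\cdots)\times F_\ell$). Each letter in such a product remembers the factor $F_\alpha$, and the copy of $M^n$, from which it comes; the total derivatives $D^{(\alpha)}$ over the $\alpha$-th copy act only on the letters and coefficients of the $\alpha$-th factor. **Derivatives.** $\overrightarrow\partial/\partial b_{i,\tau}$ acts on a cyclic word by deletion without changing the cyclic order of the remaining letters: $(c_1\cdots c_\lambda)\mapsto\sum_{\nu:\,c_\nu=b_{i,\tau}}(-1)^{|c_1\cdots c_{\nu-1}|}(c_1\cdots c_{\nu-1}c_{\nu+1}\cdots c_\lambda)$; similarly (without signs) for $\partial/\partial a^i_\sigma$. The right-acting derivative is $(w)\overleftarrow\partial/\partial b_{i,\tau}=(-1)^{|w|-1}\overrightarrow\partial w/\partial b_{i,\tau}$. **BV Laplacian.** For an integral functional, $\Delta F=\int\sum_i\sum_{\sigma,\tau}(-D)^{\sigma\cup\tau}\frac{\overrightarrow\partial^2f}{\partial a^i_\sigma\,\partial b_{i,\tau}}\,\mathrm{dvol}(x)$. On a product with density word $h$, $\Delta$ acts by $\sum_{\alpha,\beta}\sum_i\sum_{\sigma,\tau}(-D^{(\alpha)})^\sigma(-D^{(\beta)})^\tau\frac{\overrightarrow\partial^{(\alpha)}}{\partial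 a^i_\sigma}\frac{\overrightarrow\partial^{(\beta)}}{\partial b_{i,\tau}}h$, where the superscripts say from which factor the deleted letter is taken and, for $\alpha\ne\beta$, the copies $\alpha,\beta$ of $M^n$ are identified along the diagonal $x_\alpha=x_\beta$. **Schouten bracket.** For $F$ homogeneous, the bracket $[\![\,,]\!]$ is defined by $\Delta(F\times G)=\Delta F\times G+(-1)^{|F|}[\![F,G]\!]+(-1)^{|F|}F\times\Delta G$. Here $\Delta F\times G$ and $F\times\Delta G$ are the parts of $\Delta(F\times G)$ in which both deleted letters come from $F$, resp. from $G$. Explicitly, for integral functionals, $[\![F,G]\!]=\int\sum\bigl\{(f)\frac{\overleftarrow\partial}{\partial a^i_\sigma}(-\overleftarrow D)^\sigma\times(-\overrightarrow D)^\tau\frac{\overrightarrow\partial}{\partial b_{i,\tau}}(g)-(f)\frac{\overleftarrow\partial}{\partial b_{i,\sigma}}(-\overleftarrow D)^\sigma\times(-\overrightarrow D)^\tau\frac{\overrightarrow\partial}{\partial a^i_\tau}(g)\bigr\}\mathrm{dvol}(x)$, where the product word $f\times g$ is formed first and the derivatives then act on the letters of the respective factor. **Conventions for composed expressions.** (1) Multiplication first, variation afterwards: in any expression containing $\Delta$, $[\![\,,]\!]$ and several functionals, first the product word (with its bracketing) is formed, and then the operators act on the letters of the indicated factors inside it, with the usual graded signs. (2) When $\Delta$ and $[\![\,,]\!]$ are composed, all partial derivatives act on the densities first, while the total derivatives (each over its own copy of $M^n$, acting only on what remains of the respective density) and the restriction to the diagonals are performed at the very end. *)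

theory Defs
  imports
    "HOL-Analysis.Analysis"
    "HOL-Library.Multiset"
    "HOL-Library.Poly_Mapping"
    "HOL-Library.Function_Algebras"
begin

section \<open>Letters, words, and the free associative algebra\<close>

text \<open>
  The letters \<open>a\<^sup>i\<^sub>\<sigma>\<close> (even) and \<open>b\<^sub>i\<^sub>,\<^sub>\<sigma>\<close> (odd); a multi-index is a multiset of coordinate indices.
  The field \<open>copy\<close> names the factor of a product, and thereby the copy of the base manifold, from
  which the letter comes; it is of type \<^typ>\<open>unit\<close> for a single integral functional.
\<close>

datatype ('l, 'm, 'n) letter =
  is_even: Even_letter (copy: 'l) (field: 'm) (jet: "'n multiset")
| is_odd: Odd_letter (copy: 'l) (field: 'm) (jet: "'n multiset")

type_synonym ('l, 'm, 'n) word = "('l, 'm, 'n) letter list"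

definition degree :: "('l, 'm, 'n) word \<Rightarrow> nat" where
  "degree u = length (filter is_odd u)"

text \<open>\<open>signed k x\<close> is \<open>(-1)\<^sup>k x\<close>.\<close>

definition signed :: "int \<Rightarrow> 'a::uminus \<Rightarrow> 'a" where
  "signed k x = (if even k then x else - x)"

text \<open>
  Elements of the free algebra are finitely supported maps from words to coefficients.
  If \<open>T u c\<close> is additive in \<open>c\<close>, then \<open>extend T\<close> is the additive map with \<open>c u \<mapsto> T u c\<close>.
\<close>

definition extend ::
  "('a \<Rightarrow> 'c::zero \<Rightarrow> ('b \<Rightarrow>\<^sub>0 'd::comm_monoid_add)) \<Rightarrow> ('a \<Rightarrow>\<^sub>0 'c) \<Rightarrow> ('b \<Rightarrow>\<^sub>0 'd)" where
  "extend T f = (\<Sum>u\<in>Poly_Mapping.keys f. T u (Poly_Mapping.lookup f u))"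

definition concat_mult ::
  "('a list \<Rightarrow>\<^sub>0 'c::comm_ring_1) \<Rightarrow> ('a list \<Rightarrow>\<^sub>0 'c) \<Rightarrow> ('a list \<Rightarrow>\<^sub>0 'c)" where
  "concat_mult f g =
     extend (\<lambda>u c. extend (\<lambda>v d. Poly_Mapping.single (u @ v) (c * d)) g) f"

definition scale :: "'c::comm_ring_1 \<Rightarrow> ('a list \<Rightarrow>\<^sub>0 'c) \<Rightarrow> ('a list \<Rightarrow>\<^sub>0 'c)" where
  "scale c f = concat_mult (Poly_Mapping.single [] c) f"


section \<open>Cyclic words and their product\<close>

definition rot ::
  "(('l, 'm, 'n) word \<Rightarrow>\<^sub>0 'c::comm_ring_1) \<Rightarrow> (('l, 'm, 'n) word \<Rightarrow>\<^sub>0 'c)" where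
  "rot = extend (\<lambda>u c.
     if u = [] then Poly_Mapping.single [] c
     else Poly_Mapping.single (last u # butlast u)
            (signed (int (degree (butlast u) * degree [last u])) c))"

text \<open>
  Cyclic words are elements of the free algebra modulo the span of all \<open>w - \<tt> w\<close>, which is the
  image of \<open>1 - \<tt>\<close>. The operations below are defined on representatives.
\<close>

definition cyc_eq ::
  "(('l, 'm, 'n) word \<Rightarrow>\<^sub>0 'c::comm_ring_1) \<Rightarrow> (('l, 'm, 'n) word \<Rightarrow>\<^sub>0 'c) \<Rightarrow> bool" where
  "cyc_eq f g \<longleftrightarrow> (\<exists>w. f - g = w - rot w)"

definition cyc_mult ::
  "(('l, 'm, 'n) word \<Rightarrow>\<^sub>0 ('x \<Rightarrow> real)) \<Rightarrow> (('l, 'm, 'n) word \<Rightarrow>\<^sub>0 ('x \<Rightarrow> real))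
    \<Rightarrow> (('l, 'm, 'n) word \<Rightarrow>\<^sub>0 ('x \<Rightarrow> real))" where
  "cyc_mult f g = extend (\<lambda>u c. extend (\<lambda>v d.
     if u = [] \<or> v = [] then Poly_Mapping.single (u @ v) (c * d)
     else scale (\<lambda>_. 1 / (real (length u) * real (length v)))
            (\<Sum>i<length u. \<Sum>j<length v.
               concat_mult ((rot ^^ i) (Poly_Mapping.single u c))
                           ((rot ^^ j) (Poly_Mapping.single v d)))) g) f"


section \<open>Oriented affine manifolds\<close>

type_synonym 'n square = "real ^ 'n ^ 'n"

text \<open>A chart is its domain together with the coordinate map.\<close>

type_synonym ('p, 'n) chart = "'p set \<times> ('p \<Rightarrow> real ^ 'n)"

text \<open>The matrix \<open>A\<close> is the Jacobian at \<open>p\<close> of a coordinate change that is affine near \<open>p\<close>.\<close>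

definition transition ::
  "('p::topological_space, 'n::finite) chart \<Rightarrow> ('p, 'n) chart \<Rightarrow> 'p \<Rightarrow> 'n square \<Rightarrow> bool" where
  "transition \<phi> \<psi> p A \<longleftrightarrow> (\<exists>v. \<forall>\<^sub>F q in nhds p. snd \<psi> q = A *v snd \<phi> q + v)"

definition oriented_affine_atlas ::
  "('p::{t2_space, second_countable_topology}, 'n::finite) chart set \<Rightarrow> bool" where
  "oriented_affine_atlas \<A> \<longleftrightarrow>
     (\<Union>\<phi>\<in>\<A>. fst \<phi>) = UNIV \<and>
     (\<forall>(U, x)\<in>\<A>. open U \<and> open (x ` U) \<and> homeomorphism U (x ` U) x (inv_into U x)) \<and>
     (\<forall>\<phi>\<in>\<A>. \<forall>\<psi>\<in>\<A>. \<forall>p\<in>fst \<phi> \<inter> fst \<psi>. \<exists>A. transition \<phi> \<psi> p A \<and> det A > 0)"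

text \<open>The partial derivative \<open>\<partial>/\<partial>x\<^sup>k\<close> in a chart; it is meaningful at points of the chart only.\<close>

definition pd :: "('p, 'n::finite) chart \<Rightarrow> 'n \<Rightarrow> ('p \<Rightarrow> real) \<Rightarrow> 'p \<Rightarrow> real" where
  "pd \<phi> k c p =
     deriv (\<lambda>t. c (inv_into (fst \<phi>) (snd \<phi>) (snd \<phi> p + t *\<^sub>R axis k 1))) 0"

definition smooth :: "('p, 'n::finite) chart \<Rightarrow> ('p \<Rightarrow> real) \<Rightarrow> bool" where
  "smooth \<phi> c \<longleftrightarrow>
     (\<forall>ks. (\<lambda>z. foldr (pd \<phi>) ks c (inv_into (fst \<phi>) (snd \<phi>) z))
             differentiable_on (snd \<phi> ` fst \<phi>))"

text \<open>The volume element is \<open>vol \<phi>\<close> times the coordinate volume form of the chart \<open>\<phi>\<close>.\<close>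

definition volume_element ::
  "('p::topological_space, 'n::finite) chart set \<Rightarrow> (('p, 'n) chart \<Rightarrow> 'p \<Rightarrow> real) \<Rightarrow> bool" where
  "volume_element \<A> vol \<longleftrightarrow>
     (\<forall>\<phi>\<in>\<A>. smooth \<phi> (vol \<phi>) \<and> (\<forall>p\<in>fst \<phi>. vol \<phi> p > 0)) \<and>
     (\<forall>\<phi>\<in>\<A>. \<forall>\<psi>\<in>\<A>. \<forall>p\<in>fst \<phi> \<inter> fst \<psi>. \<forall>A.
        transition \<phi> \<psi> p A \<longrightarrow> vol \<phi> p = det A * vol \<psi> p)"


section \<open>Densities and integral functionals\<close>

text \<open>Cyclic words, by representatives, over one copy of the base manifold; they are written in the
  letters of a chart, so that a globally defined density is a family over the charts.\<close>

type_synonym ('p, 'm, 'n) words = "(unit, 'm, 'n) word \<Rightarrow>\<^sub>0 ('p \<Rightarrow> real)"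
type_synonym ('p, 'm, 'n) density = "('p, 'n) chart \<Rightarrow> ('p, 'm, 'n) words"

definition at_point :: "'p \<Rightarrow> ('u \<Rightarrow>\<^sub>0 ('p \<Rightarrow> real)) \<Rightarrow> ('u \<Rightarrow>\<^sub>0 real)" where
  "at_point p = extend (\<lambda>u c. Poly_Mapping.single u (c p))"

text \<open>
  If \<open>y = A x + v\<close>, then \<open>\<partial>/\<partial>x\<^sup>k = \<Sum>\<^sub>l A\<^sub>l\<^sub>k \<partial>/\<partial>y\<^sup>l\<close>, and the letters of the chart \<open>x\<close> are expanded in
  those of the chart \<open>y\<close> accordingly.
\<close>

definition change_letter ::
  "'n::{finite, linorder} square \<Rightarrow> ('l, 'm, 'n) letter \<Rightarrow> (('l, 'm, 'n) word \<Rightarrow>\<^sub>0 real)" where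
  "change_letter A l =
     (let ks = sorted_list_of_multiset (jet l) in
      \<Sum>ls | length ls = length ks.
        Poly_Mapping.single
          [case l of Even_letter s i _ \<Rightarrow> Even_letter s i (mset ls)
                   | Odd_letter s i _ \<Rightarrow> Odd_letter s i (mset ls)]
          (\<Prod>j<length ks. A $ (ls ! j) $ (ks ! j)))"

definition change_coordinates ::
  "'n::{finite, linorder} square \<Rightarrow> (('l, 'm, 'n) word \<Rightarrow>\<^sub>0 real)
    \<Rightarrow> (('l, 'm, 'n) word \<Rightarrow>\<^sub>0 real)" where
  "change_coordinates A = extend (\<lambda>u r.
     scale r (foldr (\<lambda>l w. concat_mult (change_letter A l) w) u (Poly_Mapping.single [] 1)))"

definition smooth_words :: "('p, 'n::finite) chart \<Rightarrow> ('p, 'm, 'n) words \<Rightarrow> bool" where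
  "smooth_words \<phi> f \<longleftrightarrow> (\<forall>u. smooth \<phi> (Poly_Mapping.lookup f u))"

definition is_density ::
  "('p::topological_space, 'n::{finite, linorder}) chart set \<Rightarrow> ('p, 'm, 'n) density \<Rightarrow> bool" where
  "is_density \<A> f \<longleftrightarrow>
     (\<forall>\<phi>\<in>\<A>. smooth_words \<phi> (f \<phi>)) \<and>
     (\<forall>\<phi>\<in>\<A>. \<forall>\<psi>\<in>\<A>. \<forall>p\<in>fst \<phi> \<inter> fst \<psi>. \<forall>A. transition \<phi> \<psi> p A \<longrightarrow>
        cyc_eq (change_coordinates A (at_point p (f \<phi>))) (at_point p (f \<psi>)))"

definition homogeneous ::
  "('p, 'n) chart set \<Rightarrow> nat \<Rightarrow> ('p, 'm, 'n) density \<Rightarrow> bool" where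
  "homogeneous \<A> d f \<longleftrightarrow> (\<forall>\<phi>\<in>\<A>. \<forall>u\<in>Poly_Mapping.keys (f \<phi>). degree u = d)"

text \<open>Vector fields whose components are cyclic words, with compact support.\<close>

definition is_current ::
  "('p::topological_space, 'n::{finite, linorder}) chart set
    \<Rightarrow> (('p, 'n) chart \<Rightarrow> 'n \<Rightarrow> ('p, 'm, 'n) words) \<Rightarrow> bool" where
  "is_current \<A> V \<longleftrightarrow>
     (\<forall>\<phi>\<in>\<A>. \<forall>k. smooth_words \<phi> (V \<phi> k)) \<and>
     (\<forall>\<phi>\<in>\<A>. \<forall>\<psi>\<in>\<A>. \<forall>p\<in>fst \<phi> \<inter> fst \<psi>. \<forall>A. transition \<phi> \<psi> p A \<longrightarrow>
        (\<forall>l. cyc_eq (\<Sum>k\<in>UNIV. scale (A $ l $ k) (change_coordinates A (at_point p (V \<phi> k))))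
                    (at_point p (V \<psi> l)))) \<and>
     (\<exists>K. compact K \<and>
        (\<forall>\<phi>\<in>\<A>. \<forall>p\<in>fst \<phi> - K. \<forall>k u. Poly_Mapping.lookup (V \<phi> k) u p = 0))"

primrec raise :: "'n \<Rightarrow> ('l, 'm, 'n) letter \<Rightarrow> ('l, 'm, 'n) letter" where
  "raise k (Even_letter s i \<sigma>) = Even_letter s i (add_mset k \<sigma>)"
| "raise k (Odd_letter s i \<sigma>) = Odd_letter s i (add_mset k \<sigma>)"

text \<open>The total derivative over the copy \<open>\<alpha>\<close>, given the derivative \<open>dc\<close> of coefficients over it.\<close>

definition total_deriv ::
  "('c \<Rightarrow> 'c) \<Rightarrow> 'l \<Rightarrow> 'n \<Rightarrow> (('l, 'm, 'n) word \<Rightarrow>\<^sub>0 'c::comm_ring_1)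
    \<Rightarrow> (('l, 'm, 'n) word \<Rightarrow>\<^sub>0 'c)" where
  "total_deriv dc \<alpha> k = extend (\<lambda>u c.
     Poly_Mapping.single u (dc c) +
     (\<Sum>j | j < length u \<and> copy (u ! j) = \<alpha>. Poly_Mapping.single (u[j := raise k (u ! j)]) c))"

text \<open>
  The relation \<open>\<integral> f dvol = \<integral> g dvol\<close> between integral functionals: in every chart the densities
  differ by a total divergence, \<open>(f - g) vol = \<Sum>\<^sub>k D\<^sub>k(V\<^sup>k vol)\<close> as cyclic words. On a closed manifold
  the compactness of the support of \<open>V\<close> is no restriction; otherwise it excludes boundary terms.
\<close>

definition same_functional ::
  "('p::topological_space, 'n::{finite, linorder}) chart set \<Rightarrow> (('p, 'n) chart \<Rightarrow> 'p \<Rightarrow> real)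
    \<Rightarrow> ('p, 'm, 'n) density \<Rightarrow> ('p, 'm, 'n) density \<Rightarrow> bool" where
  "same_functional \<A> vol f g \<longleftrightarrow> (\<exists>V. is_current \<A> V \<and>
     (\<forall>\<phi>\<in>\<A>. \<forall>p\<in>fst \<phi>.
        cyc_eq (at_point p (scale (vol \<phi>) (f \<phi> - g \<phi>)))
               (at_point p (\<Sum>k\<in>UNIV. total_deriv (pd \<phi> k) () k (scale (vol \<phi>) (V \<phi> k))))))"


section \<open>Products of functionals, with labelled factors\<close>

text \<open>
  The density word of a product: factors are numbered by naturals, letters remember their factor,
  and coefficients are functions of the tuple \<open>X\<close> of points of the copies of the manifold. Since all
  copies are identified along the diagonal in the end, one chart serves for all of them.
\<close>

type_synonym ('p, 'm, 'n) pwords = "(nat, 'm, 'n) word \<Rightarrow>\<^sub>0 ((nat \<Rightarrow> 'p) \<Rightarrow> real)"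

definition tag :: "nat \<Rightarrow> ('p, 'm, 'n) words \<Rightarrow> ('p, 'm, 'n) pwords" where
  "tag \<alpha> = extend (\<lambda>u c.
     Poly_Mapping.single (map (map_letter (\<lambda>_. \<alpha>) id id) u) (\<lambda>X. c (X \<alpha>)))"

definition diagonal :: "('p, 'm, 'n) pwords \<Rightarrow> ('p, 'm, 'n) words" where
  "diagonal = extend (\<lambda>u c.
     Poly_Mapping.single (map (map_letter (\<lambda>_. ()) id id) u) (\<lambda>p. c (\<lambda>_. p)))"

definition total_deriv_copy ::
  "('p, 'n::finite) chart \<Rightarrow> nat \<Rightarrow> 'n \<Rightarrow> ('p, 'm, 'n) pwords \<Rightarrow> ('p, 'm, 'n) pwords" where
  "total_deriv_copy \<phi> \<alpha> k =
     total_deriv (\<lambda>c X. pd \<phi> k (\<lambda>q. c (X(\<alpha> := q))) (X \<alpha>)) \<alpha> k"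


section \<open>The BV Laplacian and the Schouten bracket\<close>

text \<open>
  Total derivatives are performed after all partial derivatives. Until then they are recorded
  formally: the key \<open>(P, u)\<close> stands for \<open>\<Prod>\<^sub>\<alpha> (-D\<^sup>(\<^sup>\<alpha>\<^sup>))\<^bsup>P \<alpha>\<^esup> u\<close>.
\<close>

type_synonym ('p, 'm, 'n) deferred =
  "((nat \<Rightarrow> 'n multiset) \<times> (nat, 'm, 'n) word) \<Rightarrow>\<^sub>0 ((nat \<Rightarrow> 'p) \<Rightarrow> real)"

definition no_derivs :: "('p, 'm, 'n) pwords \<Rightarrow> ('p, 'm, 'n) deferred" where
  "no_derivs = extend (\<lambda>u c. Poly_Mapping.single (\<lambda>_. {#}, u) c)"

definition defer_deriv ::
  "nat \<Rightarrow> 'n multiset \<Rightarrow> ('p, 'm, 'n) deferred \<Rightarrow> ('p, 'm, 'n) deferred" where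
  "defer_deriv \<alpha> \<sigma> = extend (\<lambda>(P, u) c. Poly_Mapping.single (P(\<alpha> := P \<alpha> + \<sigma>), u) c)"

definition minus_total_deriv ::
  "('p, 'n::{finite, linorder}) chart \<Rightarrow> nat \<Rightarrow> 'n multiset
    \<Rightarrow> ('p, 'm, 'n) pwords \<Rightarrow> ('p, 'm, 'n) pwords" where
  "minus_total_deriv \<phi> \<alpha> \<sigma> f =
     signed (int (size \<sigma>)) (foldr (total_deriv_copy \<phi> \<alpha>) (sorted_list_of_multiset \<sigma>) f)"

definition perform_derivs ::
  "('p, 'n::{finite, linorder}) chart \<Rightarrow> nat list
    \<Rightarrow> ('p, 'm, 'n) deferred \<Rightarrow> ('p, 'm, 'n) pwords" where
  "perform_derivs \<phi> factors = extend (\<lambda>(P, u) c.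
     foldr (\<lambda>\<alpha>. minus_total_deriv \<phi> \<alpha> (P \<alpha>)) factors (Poly_Mapping.single u c))"

definition partial ::
  "(nat, 'm, 'n) letter \<Rightarrow> ('p, 'm, 'n) deferred \<Rightarrow> ('p, 'm, 'n) deferred" where
  "partial l = extend (\<lambda>(P, u) c. \<Sum>j | j < length u \<and> u ! j = l.
     Poly_Mapping.single (P, take j u @ drop (Suc j) u)
       (signed (int (degree (take j u) * degree [l])) c))"

text \<open>
  The part of the Laplacian that takes \<open>a\<close> from the factor \<open>\<alpha>\<close> and \<open>b\<close> from the factor \<open>\<beta>\<close>. Only
  finitely many multi-indices give a nonzero summand.
\<close>

definition laplacian_part ::
  "nat \<Rightarrow> nat \<Rightarrow> ('p, 'm::finite, 'n) deferred \<Rightarrow> ('p, 'm, 'n) deferred" where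
  "laplacian_part \<alpha> \<beta> f = (\<Sum>i\<in>UNIV. Sum_any (\<lambda>(\<sigma>, \<tau>).
     defer_deriv \<alpha> \<sigma> (defer_deriv \<beta> \<tau>
       (partial (Even_letter \<alpha> i \<sigma>) (partial (Odd_letter \<beta> i \<tau>) f)))))"

definition laplacian ::
  "nat set \<Rightarrow> ('p, 'm::finite, 'n) deferred \<Rightarrow> ('p, 'm, 'n) deferred" where
  "laplacian S f = (\<Sum>\<alpha>\<in>S. \<Sum>\<beta>\<in>S. laplacian_part \<alpha> \<beta> f)"

text \<open>
  Iterated brackets of the factors of a product. All of them act on one product word, formed
  beforehand.
\<close>

datatype bracket_expr = Factor nat | Bracket bracket_expr bracket_expr

primrec factors :: "bracket_expr \<Rightarrow> nat list" where
  "factors (Factor \<alpha>) = [\<alpha>]"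
| "factors (Bracket X Y) = factors X @ factors Y"

primrec brackets :: "bracket_expr \<Rightarrow> nat" where
  "brackets (Factor \<alpha>) = 0"
| "brackets (Bracket X Y) = Suc (brackets X + brackets Y)"

primrec grading :: "(nat \<Rightarrow> nat) \<Rightarrow> bracket_expr \<Rightarrow> int" where
  "grading d (Factor \<alpha>) = int (d \<alpha>)"
| "grading d (Bracket X Y) = grading d X + grading d Y - 1"

text \<open>
  The density word of \<open>X\<close>, given that of the product of its factors in the order in which they
  occur in \<open>X\<close>; further factors may follow on the right. In a bracket, first the word of \<open>X \<times> Y\<close> is
  produced, where the odd operators that constitute \<open>Y\<close> pass over \<open>X\<close>. Then
  \<open>\<Delta>(X \<times> Y) = \<Delta>X \<times> Y + (-1)\<^bsup>|X|\<^esup> [[X, Y]] + (-1)\<^bsup>|X|\<^esup> X \<times> \<Delta>Y\<close>, where the first and the last term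
  are the parts of \<open>\<Delta>(X \<times> Y)\<close> with both letters from \<open>X\<close> and from \<open>Y\<close>, respectively.
\<close>

primrec act ::
  "(nat \<Rightarrow> nat) \<Rightarrow> bracket_expr \<Rightarrow> ('p, 'm::finite, 'n) deferred \<Rightarrow> ('p, 'm, 'n) deferred" where
  "act d (Factor \<alpha>) w = w"
| "act d (Bracket X Y) w =
     (let SX = set (factors X); SY = set (factors Y);
          XY = signed (grading d X * int (brackets Y)) (act d Y (act d X w))
      in signed (grading d X) (laplacian (SX \<union> SY) XY - laplacian SX XY - laplacian SY XY))"

text \<open>The exponent in \<open>F\<^bsub>\<alpha>\<^sub>1\<^esub> \<times> \<dots> \<times> F\<^bsub>\<alpha>\<^sub>l\<^esub> = (-1)\<^bsup>\<dots>\<^esup> F\<^sub>0 \<times> F\<^sub>1 \<times> \<dots>\<close> for the graded transposition of factors.\<close>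

definition koszul :: "(nat \<Rightarrow> nat) \<Rightarrow> nat list \<Rightarrow> int" where
  "koszul d \<alpha>s =
     (\<Sum>(i, j) | i < j \<and> j < length \<alpha>s \<and> \<alpha>s ! j < \<alpha>s ! i. int (d (\<alpha>s ! i) * d (\<alpha>s ! j)))"

text \<open>
  The density of an iterated bracket \<open>X\<close> of the factors \<open>F = Factor 0\<close>, \<open>G = Factor 1\<close>,
  \<open>H = Factor 2\<close>, of gradings \<open>d 0\<close>, \<open>d 1\<close>, \<open>d 2\<close>, evaluated in the product \<open>(F \<times> G) \<times> H\<close>.
\<close>

definition bracket_density ::
  "('p, 'm::finite, 'n::{finite, linorder}) density \<Rightarrow> ('p, 'm, 'n) density \<Rightarrow> ('p, 'm, 'n) density
    \<Rightarrow> (nat \<Rightarrow> nat) \<Rightarrow> bracket_expr \<Rightarrow> ('p, 'm, 'n) density" where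
  "bracket_density f g h d X \<phi> =
     (let w = cyc_mult (cyc_mult (tag 0 (f \<phi>)) (tag 1 (g \<phi>))) (tag 2 (h \<phi>))
      in diagonal (perform_derivs \<phi> [0, 1, 2]
           (act d X (signed (koszul d (factors X)) (no_derivs w)))))"

text \<open>The bracket collects the terms with one letter from each of its arguments.\<close>

lemma laplacian_cross_terms:
  assumes "finite S" "finite T" "S \<inter> T = {}"
  shows "laplacian (S \<union> T) f - laplacian S f - laplacian T f =
    (\<Sum>\<alpha>\<in>S. \<Sum>\<beta>\<in>T. laplacian_part \<alpha> \<beta> f + laplacian_part \<beta> \<alpha> f)"
proof -
  have "(\<Sum>\<beta>\<in>T. \<Sum>\<alpha>\<in>S. laplacian_part \<beta> \<alpha> f) = (\<Sum>\<alpha>\<in>S. \<Sum>\<beta>\<in>T. laplacian_part \<beta> \<alpha> f)"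
    by (rule sum.swap)
  then show ?thesis
    by (simp add: laplacian_def sum.union_disjoint[OF assms] sum.distrib)
qed

end

theory Submission
  imports Defs
begin

text \<open>
  The bracket of two factors consists of the terms of the Laplacian with one letter from each of them.
  Write \<open>P\<^sub>F\<^sub>G\<close> for the sum of these terms (\<open>pairing\<close>). In the product word of three factors,
  every double bracket is, up to a sign that depends on the gradings, a sum of two compositions of
  pairings: the outer bracket acts on either of the two factors of the inner one. For instance
  \<open>[[F, [[G, H]]]]\<close> becomes \<open>(P\<^sub>F\<^sub>G + P\<^sub>F\<^sub>H) P\<^sub>G\<^sub>H\<close>.

  Since each term of the Laplacian deletes exactly one odd letter, all these terms anticommute
  (\<open>partial_partial\<close>, \<open>laplacian_part_anticommute\<close>). Here it matters that all partial derivatives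
  act on the density word first, while the total derivatives are merely recorded: no total derivative
  stands between two partial ones. Once the signs are collected, each of the three identities says
  that the anticommutators of \<open>P\<^sub>F\<^sub>G\<close>, \<open>P\<^sub>F\<^sub>H\<close> and \<open>P\<^sub>G\<^sub>H\<close> cancel in pairs.

  The identity holds for deferred expressions, before total derivatives are performed. To transport
  it to densities, one needs that performing the derivatives is additive (\<open>evaluate_add\<close>). This is an
  analytic fact: it uses that all coefficients are polynomial combinations of smooth functions of
  the points in the single copies, and it holds at points of the chart. At these points the two sides
  of each identity agree as words, so the functionals agree with zero as the current.
\<close>

section \<open>Additive maps of free modules\<close>

abbreviation additive_map :: "('a::ab_group_add \<Rightarrow> 'b::ab_group_add) \<Rightarrow> bool" where
  "additive_map \<equiv> Modules.additive"

lemma lookup_extend: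
  "Poly_Mapping.lookup (extend T f) v
    = (\<Sum>u\<in>Poly_Mapping.keys f. Poly_Mapping.lookup (T u (Poly_Mapping.lookup f u)) v)"
  by (simp add: extend_def lookup_sum)

lemma extend_superset:
  assumes "finite K" "Poly_Mapping.keys f \<subseteq> K" "\<And>u. T u 0 = 0"
  shows "extend T f = (\<Sum>u\<in>K. T u (Poly_Mapping.lookup f u))"
  unfolding extend_def
  using assms by (intro sum.mono_neutral_left) (auto simp: in_keys_iff)

lemma extend_single:
  assumes "T u 0 = 0"
  shows "extend T (Poly_Mapping.single u c) = T u c"
  using assms by (cases "c = 0") (auto simp: extend_def)

lemma extend_zero [simp]: "extend T 0 = 0"
  by (simp add: extend_def)

lemma additive_extend:
  fixes T :: "'a \<Rightarrow> 'c::ab_group_add \<Rightarrow> ('b \<Rightarrow>\<^sub>0 'd::ab_group_add)"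
  assumes "\<And>u. additive_map (T u)"
  shows "additive_map (extend T)"
proof
  fix f g :: "'a \<Rightarrow>\<^sub>0 'c"
  let ?K = "Poly_Mapping.keys f \<union> Poly_Mapping.keys g"
  have *: "extend T k = (\<Sum>u\<in>?K. T u (Poly_Mapping.lookup k u))"
    if "Poly_Mapping.keys k \<subseteq> ?K" for k
    using that by (intro extend_superset) (auto simp: additive.zero[OF assms])
  show "extend T (f + g) = extend T f + extend T g"
    using Poly_Mapping.keys_add[of f g]
    by (simp add: * lookup_add additive.add[OF assms] sum.distrib)
qed

lemma additive_ext:
  fixes M N :: "('a \<Rightarrow>\<^sub>0 'c::ab_group_add) \<Rightarrow> 'd::ab_group_add"
  assumes "additive_map M" "additive_map N"
    and "\<And>u c. M (Poly_Mapping.single u c) = N (Poly_Mapping.single u c)"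
  shows "M = N"
proof
  fix f :: "'a \<Rightarrow>\<^sub>0 'c"
  have f: "f = (\<Sum>u\<in>Poly_Mapping.keys f. Poly_Mapping.single u (Poly_Mapping.lookup f u))"
    by (rule poly_mapping_eqI) (simp add: lookup_sum lookup_single when_def in_keys_iff)
  have "M f = (\<Sum>u\<in>Poly_Mapping.keys f. M (Poly_Mapping.single u (Poly_Mapping.lookup f u)))"
    by (subst f) (rule additive.sum[OF assms(1)])
  also have "\<dots> = (\<Sum>u\<in>Poly_Mapping.keys f. N (Poly_Mapping.single u (Poly_Mapping.lookup f u)))"
    by (simp add: assms(3))
  also have "\<dots> = N f"
    by (subst (3) f) (rule additive.sum[OF assms(2), symmetric])
  finally show "M f = N f" .
qed

lemma additive_comp:
  assumes "additive_map M" "additive_map N"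
  shows "additive_map (\<lambda>f. M (N f))"
  using assms by (simp add: Modules.additive_def)

lemma additive_plus:
  fixes M N :: "'a::ab_group_add \<Rightarrow> 'b::ab_group_add"
  assumes "additive_map M" "additive_map N"
  shows "additive_map (\<lambda>f. M f + N f)"
  using assms by (simp add: Modules.additive_def)

lemma additive_sums:
  fixes M :: "'i \<Rightarrow> 'a::ab_group_add \<Rightarrow> 'b::ab_group_add"
  assumes "\<And>i. i \<in> I \<Longrightarrow> additive_map (M i)"
  shows "additive_map (\<lambda>f. \<Sum>i\<in>I. M i f)"
  using assms by (simp add: Modules.additive_def sum.distrib)

lemma additive_single: "additive_map (Poly_Mapping.single u)"
  by (simp add: Modules.additive_def single_add)

lemma additive_signed: "additive_map (signed k :: 'a::ab_group_add \<Rightarrow> 'a)"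
  by (simp add: Modules.additive_def signed_def)

lemma signed_signed [simp]: "signed k (signed l x) = signed (k + l) (x::'a::ab_group_add)"
  by (simp add: signed_def)

lemma signed_zero [simp]: "signed k 0 = (0::'a::ab_group_add)"
  by (simp add: signed_def)

lemma additive_apply_signed:
  assumes "additive_map M"
  shows "M (signed k x) = signed k (M x)"
  by (simp add: signed_def additive.minus[OF assms])

section \<open>Partial derivatives commute in the graded sense\<close>

definition sign_exp :: "('l, 'm, 'n) letter \<Rightarrow> ('l, 'm, 'n) letter \<Rightarrow> int" where
  "sign_exp x y = (if is_odd x \<and> is_odd y then 1 else 0)"

definition prepend ::
  "(nat, 'm, 'n) letter \<Rightarrow> ('p, 'm, 'n) deferred \<Rightarrow> ('p, 'm, 'n) deferred" where
  "prepend x = extend (\<lambda>(P, u) c. Poly_Mapping.single (P, x # u) c)"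

lemma additive_extend_pair:
  assumes "\<And>P u. additive_map (T P u)"
  shows "additive_map (extend (case_prod T))"
  by (rule additive_extend) (use assms in \<open>simp add: case_prod_unfold\<close>)

lemma extend_single_pair:
  assumes "T P u 0 = 0"
  shows "extend (case_prod T) (Poly_Mapping.single (P, u) c) = T P u c"
  using assms by (simp add: extend_single)

lemma additive_prepend: "additive_map (prepend x)"
  unfolding prepend_def
  by (intro additive_extend_pair additive_single)

lemma additive_defer_deriv: "additive_map (defer_deriv \<alpha> \<sigma>)"
  unfolding defer_deriv_def
  by (intro additive_extend_pair additive_single)

lemma additive_partial: "additive_map (partial l)"
  unfolding partial_def
  by (intro additive_extend_pair additive_sums additive_comp[OF additive_single additive_signed])

lemma defer_deriv_single [simp]:
  "defer_deriv \<alpha> \<sigma> (Poly_Mapping.single (P, u) c) = Poly_Mapping.single (P(\<alpha> := P \<alpha> + \<sigma>), u) c"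
  by (simp add: defer_deriv_def extend_single)

lemma prepend_single [simp]:
  "prepend x (Poly_Mapping.single (P, u) c) = Poly_Mapping.single (P, x # u) c"
  by (simp add: prepend_def extend_single)

lemma partial_single:
  "partial l (Poly_Mapping.single (P, u) c) = (\<Sum>j | j < length u \<and> u ! j = l.
     Poly_Mapping.single (P, take j u @ drop (Suc j) u)
       (signed (int (degree (take j u) * degree [l])) c))"
  unfolding partial_def by (rule extend_single_pair) simp

lemma partial_single_Nil [simp]: "partial l (Poly_Mapping.single (P, []) c) = 0"
  by (simp add: partial_single)

text \<open>
  Deleting letters from \<open>x # u\<close> deletes either the head or a letter of \<open>u\<close>, which an odd derivative
  reaches by passing over \<open>x\<close>. This is a graded Leibniz rule for left multiplication by a letter, and
  it replaces the bookkeeping of positions by induction on words.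
\<close>

lemma partial_single_Cons:
  "partial l (Poly_Mapping.single (P, x # u) c) =
     (if x = l then Poly_Mapping.single (P, u) c else 0) +
     signed (sign_exp x l) (prepend x (partial l (Poly_Mapping.single (P, u) c)))"
proof -
  let ?t = "\<lambda>v j. Poly_Mapping.single (P, take j v @ drop (Suc j) v)
       (signed (int (degree (take j v) * degree [l])) c)"
  let ?J = "{j. j < length u \<and> u ! j = l}"
  have set: "{j. j < length (x # u) \<and> (x # u) ! j = l}
      = (if x = l then {0} else {}) \<union> Suc ` ?J"
  proof (rule set_eqI)
    show "i \<in> {j. j < length (x # u) \<and> (x # u) ! j = l} \<longleftrightarrow>
        i \<in> (if x = l then {0} else {}) \<union> Suc ` ?J" for i
      by (cases i) auto
  qed
  have step: "?t (x # u) (Suc j) = signed (sign_exp x l) (prepend x (?t u j))" for j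
    by (auto simp: signed_def sign_exp_def degree_def single_uminus additive.minus[OF additive_prepend])
  have "(\<Sum>j | j < length (x # u) \<and> (x # u) ! j = l. ?t (x # u) j)
      = (if x = l then ?t (x # u) 0 else 0) + (\<Sum>j\<in>?J. ?t (x # u) (Suc j))"
    unfolding set by (subst sum.union_disjoint) (auto simp: sum.reindex)
  also have "(\<Sum>j\<in>?J. ?t (x # u) (Suc j)) = signed (sign_exp x l) (prepend x (\<Sum>j\<in>?J. ?t u j))"
    by (simp only: step additive.sum[OF additive_signed] additive.sum[OF additive_prepend])
  finally show ?thesis
    by (simp add: partial_single signed_def degree_def)
qed

lemma partial_prepend:
  fixes f :: "('p, 'm, 'n) deferred"
  shows "partial l (prepend x f) =
     (if x = l then f else 0) + signed (sign_exp x l) (prepend x (partial l f))"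
proof -
  let ?N = "\<lambda>f :: ('p, 'm, 'n) deferred.
     (if x = l then f else 0) + signed (sign_exp x l) (prepend x (partial l f))"
  have "(\<lambda>f. partial l (prepend x f)) = ?N"
  proof (rule additive_ext)
    show "additive_map (\<lambda>f :: ('p, 'm, 'n) deferred. partial l (prepend x f))"
      by (rule additive_comp[OF additive_partial additive_prepend])
    have "additive_map (\<lambda>f :: ('p, 'm, 'n) deferred. if x = l then f else 0)"
      by (simp add: Modules.additive_def)
    then show "additive_map ?N"
      by (rule additive_plus[OF _ additive_comp[OF additive_signed
            additive_comp[OF additive_prepend additive_partial]]])
  qed (auto simp: partial_single_Cons)
  from fun_cong[OF this, of f] show ?thesis .
qed

text \<open>
  Both orders of deletion give the same words; by the rule for a prepended letter, the signs are
  compared one letter at a time. In particular two odd derivatives anticommute, which is the source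
  of every cancellation in the Jacobi identity.
\<close>

lemma partial_partial:
  fixes f :: "('p, 'm, 'n) deferred"
  shows "partial l (partial k f) = signed (sign_exp l k) (partial k (partial l f))"
proof -
  have "(\<lambda>f :: ('p, 'm, 'n) deferred. partial l (partial k f))
      = (\<lambda>f. signed (sign_exp l k) (partial k (partial l f)))"
  proof (rule additive_ext)
    fix Pu :: "(nat \<Rightarrow> 'n multiset) \<times> (nat, 'm, 'n) word" and c :: "(nat \<Rightarrow> 'p) \<Rightarrow> real"
    obtain P u where Pu: "Pu = (P, u)"
      by (cases Pu)
    have "partial l (partial k (Poly_Mapping.single (P, u) c))
        = signed (sign_exp l k) (partial k (partial l (Poly_Mapping.single (P, u) c)))"
    proof (induction u)
      case Nil
      show ?case
        by (simp add: additive.zero[OF additive_partial])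
    next
      case (Cons x u)
      define S :: "('p, 'm, 'n) deferred" where "S = Poly_Mapping.single (P, u) c"
      define A where "A = partial l S"
      define B where "B = partial k S"
      have IH: "partial l B = signed (sign_exp l k) (partial k A)"
        using Cons by (simp add: S_def A_def B_def)
      have "partial l (partial k (Poly_Mapping.single (P, x # u) c))
          = (if x = k then A else 0) + signed (sign_exp x k)
              ((if x = l then B else 0) + signed (sign_exp x l) (prepend x (partial l B)))"
        by (simp add: partial_single_Cons partial_prepend additive.add[OF additive_partial]
          additive.zero[OF additive_partial] additive_apply_signed[OF additive_partial]
          A_def B_def flip: S_def)
      moreover have "partial k (partial l (Poly_Mapping.single (P, x # u) c))
          = (if x = l then B else 0) + signed (sign_exp x l)
              ((if x = k then A else 0) + signed (sign_exp x k) (prepend x (partial k A)))"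
        by (simp add: partial_single_Cons partial_prepend additive.add[OF additive_partial]
          additive.zero[OF additive_partial] additive_apply_signed[OF additive_partial]
          A_def B_def flip: S_def)
      moreover have "A = B" if "k = l"
        using that by (simp add: A_def B_def)
      ultimately show ?case
        unfolding IH
        by (cases "is_odd x"; cases "is_odd k"; cases "is_odd l"; cases "x = k"; cases "x = l")
          (auto simp: sign_exp_def signed_def additive.minus[OF additive_prepend])
    qed
    then show "partial l (partial k (Poly_Mapping.single Pu c))
        = signed (sign_exp l k) (partial k (partial l (Poly_Mapping.single Pu c)))"
      by (simp add: Pu)
  qed (rule additive_comp[OF additive_partial additive_partial]
      additive_comp[OF additive_signed additive_comp[OF additive_partial additive_partial]])+
  from fun_cong[OF this, of f] show ?thesis .
qed

lemma partial_defer_deriv: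
  fixes f :: "('p, 'm, 'n) deferred"
  shows "partial l (defer_deriv \<alpha> \<sigma> f) = defer_deriv \<alpha> \<sigma> (partial l f)"
proof -
  have "(\<lambda>f :: ('p, 'm, 'n) deferred. partial l (defer_deriv \<alpha> \<sigma> f))
      = (\<lambda>f. defer_deriv \<alpha> \<sigma> (partial l f))"
  proof (rule additive_ext)
    show "partial l (defer_deriv \<alpha> \<sigma> (Poly_Mapping.single Pu c))
        = defer_deriv \<alpha> \<sigma> (partial l (Poly_Mapping.single Pu c))"
      for Pu and c :: "(nat \<Rightarrow> 'p) \<Rightarrow> real"
      by (cases Pu) (simp add: partial_single additive.sum[OF additive_defer_deriv])
  qed (rule additive_comp[OF additive_partial additive_defer_deriv]
      additive_comp[OF additive_defer_deriv additive_partial])+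
  from fun_cong[OF this, of f] show ?thesis .
qed

lemma defer_deriv_commute:
  fixes f :: "('p, 'm, 'n) deferred"
  shows "defer_deriv \<alpha> \<sigma> (defer_deriv \<beta> \<tau> f) = defer_deriv \<beta> \<tau> (defer_deriv \<alpha> \<sigma> f)"
proof -
  have "(\<lambda>f :: ('p, 'm, 'n) deferred. defer_deriv \<alpha> \<sigma> (defer_deriv \<beta> \<tau> f))
      = (\<lambda>f. defer_deriv \<beta> \<tau> (defer_deriv \<alpha> \<sigma> f))"
  proof (rule additive_ext)
    show "defer_deriv \<alpha> \<sigma> (defer_deriv \<beta> \<tau> (Poly_Mapping.single Pu c))
        = defer_deriv \<beta> \<tau> (defer_deriv \<alpha> \<sigma> (Poly_Mapping.single Pu c))"
      for Pu and c :: "(nat \<Rightarrow> 'p) \<Rightarrow> real"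
    proof (cases Pu)
      case (Pair P u)
      have "(P(\<beta> := P \<beta> + \<tau>))(\<alpha> := (P(\<beta> := P \<beta> + \<tau>)) \<alpha> + \<sigma>)
          = (P(\<alpha> := P \<alpha> + \<sigma>))(\<beta> := (P(\<alpha> := P \<alpha> + \<sigma>)) \<beta> + \<tau>)"
        by (auto simp: fun_eq_iff add_ac)
      then show ?thesis
        by (simp only: Pair defer_deriv_single)
    qed
  qed (rule additive_comp[OF additive_defer_deriv additive_defer_deriv])+
  from fun_cong[OF this, of f] show ?thesis .
qed

section \<open>Partial Laplacians anticommute\<close>

definition laplacian_term ::
  "nat \<Rightarrow> nat \<Rightarrow> 'm \<Rightarrow> 'n multiset \<Rightarrow> 'n multiset \<Rightarrow> ('p, 'm, 'n) deferred \<Rightarrow> ('p, 'm, 'n) deferred" where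
  "laplacian_term \<alpha> \<beta> i \<sigma> \<tau> f = defer_deriv \<alpha> \<sigma> (defer_deriv \<beta> \<tau>
     (partial (Even_letter \<alpha> i \<sigma>) (partial (Odd_letter \<beta> i \<tau>) f)))"

lemma additive_laplacian_term: "additive_map (laplacian_term \<alpha> \<beta> i \<sigma> \<tau>)"
  unfolding laplacian_term_def
  by (rule additive_comp[OF additive_defer_deriv additive_comp[OF additive_defer_deriv
      additive_comp[OF additive_partial additive_partial]]])

text \<open>
  Every summand of a Laplacian contains exactly one odd derivative, and the recorded total
  derivatives commute with everything.
\<close>

lemma laplacian_term_anticommute:
  fixes f :: "('p, 'm, 'n) deferred"
  shows
  "laplacian_term \<alpha> \<beta> i \<sigma> \<tau> (laplacian_term \<gamma> \<delta> j \<rho> \<upsilon> f) =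
    - laplacian_term \<gamma> \<delta> j \<rho> \<upsilon> (laplacian_term \<alpha> \<beta> i \<sigma> \<tau> f)"
proof -
  let ?a = "Even_letter \<alpha> i \<sigma>" and ?b = "Odd_letter \<beta> i \<tau>"
  let ?a' = "Even_letter \<gamma> j \<rho>" and ?b' = "Odd_letter \<delta> j \<upsilon>"
  have ev: "partial ?a (partial k f) = partial k (partial ?a f)" for k f
    by (subst partial_partial) (simp add: sign_exp_def signed_def)
  have odd: "partial ?b (partial ?b' f) = - partial ?b' (partial ?b f)" for f
    by (subst partial_partial) (simp add: sign_exp_def signed_def)
  have ev': "partial ?a' (partial k f) = partial k (partial ?a' f)" for k f
    by (subst partial_partial) (simp add: sign_exp_def signed_def)
  have "partial ?a (partial ?b (partial ?a' (partial ?b' f)))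
      = partial ?a (partial ?a' (partial ?b (partial ?b' f)))"
    by (simp only: ev'[of ?b])
  also have "\<dots> = partial ?a' (partial ?a (partial ?b (partial ?b' f)))"
    by (rule ev)
  also have "\<dots> = - partial ?a' (partial ?a (partial ?b' (partial ?b f)))"
    by (simp only: odd[of f] additive.minus[OF additive_partial])
  also have "\<dots> = - partial ?a' (partial ?b' (partial ?a (partial ?b f)))"
    by (simp only: ev[of ?b'])
  finally have *: "partial ?a (partial ?b (partial ?a' (partial ?b' f)))
      = - partial ?a' (partial ?b' (partial ?a (partial ?b f)))" .
  have D: "defer_deriv \<alpha> \<sigma> (defer_deriv \<beta> \<tau> (defer_deriv \<gamma> \<rho> (defer_deriv \<delta> \<upsilon> f)))
     = defer_deriv \<gamma> \<rho> (defer_deriv \<delta> \<upsilon> (defer_deriv \<alpha> \<sigma> (defer_deriv \<beta> \<tau> f)))" for f :: "('p, 'm, 'n) deferred"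
    by (metis defer_deriv_commute)
  show ?thesis
    unfolding laplacian_term_def partial_defer_deriv * D 
    by (simp only: additive.minus[OF additive_defer_deriv])
qed

text \<open>
  Only the jets that occur in a word contribute to a Laplacian. Applying a Laplacian creates no new
  ones, so the formally infinite sums over multi-indices in a composition of several Laplacians can
  all be taken over one finite set.
\<close>

definition jets :: "('p, 'm, 'n) deferred \<Rightarrow> 'n multiset set" where
  "jets f = (\<Union>(P, u)\<in>Poly_Mapping.keys f. jet ` set u)"

lemma finite_jets: "finite (jets f)"
  by (auto simp: jets_def)

lemma jets_add: "jets (f + g) \<subseteq> jets f \<union> jets g"
  using Poly_Mapping.keys_add[of f g] by (fastforce simp: jets_def)

lemma jets_sum: "(\<And>i. i \<in> I \<Longrightarrow> jets (F i) \<subseteq> J) \<Longrightarrow> jets (\<Sum>i\<in>I. F i) \<subseteq> J"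
proof (induction I rule: infinite_finite_induct)
  case (insert i I)
  then show ?case using jets_add[of "F i" "sum F I"] by auto
qed (auto simp: jets_def)

lemma jets_extend:
  assumes "\<And>P u c. (P, u) \<in> Poly_Mapping.keys f \<Longrightarrow> jets (T (P, u) c) \<subseteq> jet ` set u"
  shows "jets (extend T f) \<subseteq> jets f"
  unfolding extend_def 
proof (rule jets_sum)
  fix k assume k: "k \<in> Poly_Mapping.keys f"
  obtain P u where "k = (P, u)" by (cases k)
  with k assms[of P u "Poly_Mapping.lookup f k"] show "jets (T k (Poly_Mapping.lookup f k)) \<subseteq> jets f"
    by (force simp: jets_def[of f])
qed

lemma jets_single: "jets (Poly_Mapping.single (P, u) c) \<subseteq> jet ` set u"
  by (auto simp: jets_def)

lemma jets_defer_deriv: "jets (defer_deriv \<alpha> \<sigma> f) \<subseteq> jets f"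
  unfolding defer_deriv_def by (rule jets_extend) (simp only: prod.case, rule jets_single)

lemma jets_partial:
  fixes f :: "('p, 'm, 'n) deferred"
  shows "jets (partial l f) \<subseteq> jets f"
  unfolding partial_def
proof (rule jets_extend)
  fix P and u :: "(nat, 'm, 'n) word" and c :: "(nat \<Rightarrow> 'p) \<Rightarrow> real"
  have "jet ` set (take j u @ drop (Suc j) u) \<subseteq> jet ` set u" for j
    by (auto dest: in_set_takeD in_set_dropD)
  then show "jets ((\<lambda>(P, u) c. \<Sum>j | j < length u \<and> u ! j = l.
     Poly_Mapping.single (P, take j u @ drop (Suc j) u)
       (signed (int (degree (take j u) * degree [l])) c)) (P, u) c) \<subseteq> jet ` set u"
    unfolding prod.case by (intro jets_sum order.trans[OF jets_single])
qed

lemma jets_laplacian_term: "jets (laplacian_term \<alpha> \<beta> i \<sigma> \<tau> f) \<subseteq> jets f"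
  unfolding laplacian_term_def
  by (intro order.trans[OF jets_defer_deriv] jets_partial order.trans[OF jets_partial])

lemma partial_eq_0: "jet l \<notin> jets f \<Longrightarrow> partial l f = 0"
  unfolding partial_def extend_def
  by (intro sum.neutral ballI) (auto simp: jets_def intro!: sum.neutral)

lemma laplacian_part_eq:
  assumes "finite J" "jets f \<subseteq> J"
  shows "laplacian_part \<alpha> \<beta> f = (\<Sum>i\<in>UNIV. \<Sum>(\<sigma>, \<tau>)\<in>J \<times> J. laplacian_term \<alpha> \<beta> i \<sigma> \<tau> f)"
proof -
  have "Sum_any (\<lambda>(\<sigma>, \<tau>). laplacian_term \<alpha> \<beta> i \<sigma> \<tau> f)
      = (\<Sum>(\<sigma>, \<tau>)\<in>J \<times> J. laplacian_term \<alpha> \<beta> i \<sigma> \<tau> f)" for i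
  proof (rule Sum_any.expand_superset)
    have "laplacian_term \<alpha> \<beta> i \<sigma> \<tau> f = 0" if "\<sigma> \<notin> J \<or> \<tau> \<notin> J" for \<sigma> \<tau>
    proof -
      have "partial (Even_letter \<alpha> i \<sigma>) (partial (Odd_letter \<beta> i \<tau>) f) = 0"
      proof (cases "\<sigma> \<in> J")
        case False
        then show ?thesis
          using assms(2) jets_partial[of "Odd_letter \<beta> i \<tau>" f] by (intro partial_eq_0) auto
      next
        case True
        then show ?thesis
          using assms(2) that
          by (subst partial_eq_0[of "Odd_letter \<beta> i \<tau>"]) (auto simp: additive.zero[OF additive_partial])
      qed
      then show ?thesis
        by (simp add: laplacian_term_def additive.zero[OF additive_defer_deriv])
    qed
    then show "{k. (case k of (\<sigma>, \<tau>) \<Rightarrow> laplacian_term \<alpha> \<beta> i \<sigma> \<tau> f) \<noteq> 0} \<subseteq> J \<times> J"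
      by auto
  qed (use assms in simp)
  then show ?thesis
    by (simp add: laplacian_part_def laplacian_term_def)
qed

lemma jets_laplacian_part: "jets (laplacian_part \<alpha> \<beta> f) \<subseteq> jets f"
  unfolding laplacian_part_eq[OF finite_jets order.refl]
  by (intro jets_sum) (auto intro: subsetD[OF jets_laplacian_term] simp: case_prod_unfold)

text \<open>
  Additivity is not immediate from a sum over all multi-indices, which needs finite support; it holds
  because one finite set of jets serves both arguments.
\<close>

lemma additive_laplacian_part:
  "additive_map (laplacian_part \<alpha> \<beta> :: ('p, 'm::finite, 'n) deferred \<Rightarrow> _)"
proof
  fix f g :: "('p, 'm::finite, 'n) deferred"
  let ?J = "jets f \<union> jets g"
  have *: "laplacian_part \<alpha> \<beta> k = (\<Sum>i\<in>UNIV. \<Sum>(\<sigma>, \<tau>)\<in>?J \<times> ?J. laplacian_term \<alpha> \<beta> i \<sigma> \<tau> k)"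
    if "jets k \<subseteq> ?J" for k :: "('p, 'm, 'n) deferred"
    using that by (intro laplacian_part_eq) (auto simp: finite_jets)
  show "laplacian_part \<alpha> \<beta> (f + g) = laplacian_part \<alpha> \<beta> f + laplacian_part \<alpha> \<beta> g"
    by (simp add: *[OF jets_add] *[OF Un_upper1] *[OF Un_upper2]
      additive.add[OF additive_laplacian_term] sum.distrib case_prod_unfold)
qed

lemma laplacian_part_anticommute:
  fixes f :: "('p, 'm::finite, 'n) deferred"
  shows "laplacian_part \<alpha> \<beta> (laplacian_part \<gamma> \<delta> f) = - laplacian_part \<gamma> \<delta> (laplacian_part \<alpha> \<beta> f)"
proof -
  let ?I = "(UNIV :: 'm set) \<times> jets f \<times> jets f"
  define L where "L \<alpha> \<beta> k g = (case k of (i, \<sigma>, \<tau>) \<Rightarrow> laplacian_term \<alpha> \<beta> i \<sigma> \<tau> g)"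
    for \<alpha> \<beta> k and g :: "('p, 'm, 'n) deferred"
  have add: "additive_map (L \<alpha> \<beta> k)" for \<alpha> \<beta> k
    by (cases k) (simp add: L_def Modules.additive_def additive.add[OF additive_laplacian_term])
  have L: "laplacian_part \<alpha> \<beta> g = (\<Sum>k\<in>?I. L \<alpha> \<beta> k g)" if "jets g \<subseteq> jets f" for g \<alpha> \<beta>
    unfolding laplacian_part_eq[OF finite_jets that] L_def
    by (simp add: sum.cartesian_product case_prod_unfold)
  have L2: "laplacian_part \<alpha> \<beta> (laplacian_part \<gamma> \<delta> f) = (\<Sum>k\<in>?I. \<Sum>l\<in>?I. L \<alpha> \<beta> k (L \<gamma> \<delta> l f))"
    for \<alpha> \<beta> \<gamma> \<delta>
    by (subst L[OF jets_laplacian_part]) (simp only: L[OF order.refl] additive.sum[OF add])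
  have anti: "L \<alpha> \<beta> k (L \<gamma> \<delta> l f) = - L \<gamma> \<delta> l (L \<alpha> \<beta> k f)" for k l
    unfolding L_def by (auto split: prod.splits intro: laplacian_term_anticommute)
  have "laplacian_part \<alpha> \<beta> (laplacian_part \<gamma> \<delta> f) = - (\<Sum>k\<in>?I. \<Sum>l\<in>?I. L \<gamma> \<delta> l (L \<alpha> \<beta> k f))"
    by (simp only: L2 anti sum_negf)
  also have "\<dots> = - laplacian_part \<gamma> \<delta> (laplacian_part \<alpha> \<beta> f)"
    unfolding L2 by (subst sum.swap) (rule refl)
  finally show ?thesis .
qed

section \<open>Rings of coefficients\<close>

definition coeffs_in :: "'c set \<Rightarrow> ('a \<Rightarrow>\<^sub>0 'c::zero) \<Rightarrow> bool" where
  "coeffs_in S f \<longleftrightarrow> (\<forall>u. Poly_Mapping.lookup f u \<in> S)"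

text \<open>
  All constructions other than total derivatives build new coefficients from old ones by ring
  operations and constants, hence preserve the words with coefficients in a given ring of
  functions.
\<close>

locale coefficient_ring =
  fixes S :: "('x \<Rightarrow> real) set"
  assumes const: "(\<lambda>_. r) \<in> S"
    and add: "c \<in> S \<Longrightarrow> c' \<in> S \<Longrightarrow> c + c' \<in> S"
    and mult: "c \<in> S \<Longrightarrow> c' \<in> S \<Longrightarrow> c * c' \<in> S"
begin

lemma zero: "0 \<in> S"
  using const[of 0] by (simp add: func_zero)

lemma minus: "c \<in> S \<Longrightarrow> - c \<in> S"
  using mult[OF const[of "-1"], of c] by (simp add: func_times fun_Compl_def)

lemma coeffs_in_zero: "coeffs_in S 0"
  by (simp add: coeffs_in_def zero)

lemma coeffs_in_add: "coeffs_in S f \<Longrightarrow> coeffs_in S g \<Longrightarrow> coeffs_in S (f + g)"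
  by (simp add: coeffs_in_def lookup_add add)

lemma coeffs_in_signed: "coeffs_in S f \<Longrightarrow> coeffs_in S (signed k f)"
  by (simp add: coeffs_in_def signed_def minus)

lemma coeffs_in_single: "c \<in> S \<Longrightarrow> coeffs_in S (Poly_Mapping.single u c)"
  by (simp add: coeffs_in_def lookup_single when_def zero)

lemma coeffs_in_sum: "(\<And>i. i \<in> I \<Longrightarrow> coeffs_in S (F i)) \<Longrightarrow> coeffs_in S (\<Sum>i\<in>I. F i)"
  by (induction I rule: infinite_finite_induct) (auto simp: coeffs_in_zero coeffs_in_add)

lemma coeffs_in_extend:
  assumes "\<And>u. coeffs_in S (T u (Poly_Mapping.lookup f u))"
  shows "coeffs_in S (extend T f)"
  unfolding extend_def by (intro coeffs_in_sum assms)

lemma coeffs_in_extend_pair: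
  assumes "coeffs_in S f" "\<And>P u c. c \<in> S \<Longrightarrow> coeffs_in S (T P u c)"
  shows "coeffs_in S (extend (case_prod T) f)"
proof (rule coeffs_in_extend)
  show "coeffs_in S ((case k of (P, u) \<Rightarrow> T P u) (Poly_Mapping.lookup f k))" for k
    using assms by (cases k) (simp add: coeffs_in_def)
qed

lemma signed: "c \<in> S \<Longrightarrow> signed k c \<in> S"
  by (simp add: signed_def minus)

lemma coeffs_in_concat_mult:
  "coeffs_in S f \<Longrightarrow> coeffs_in S g \<Longrightarrow> coeffs_in S (concat_mult f g)"
  unfolding concat_mult_def
  by (intro coeffs_in_extend coeffs_in_single mult) (auto simp: coeffs_in_def)

lemma coeffs_in_scale: "c \<in> S \<Longrightarrow> coeffs_in S f \<Longrightarrow> coeffs_in S (scale c f)"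
  unfolding scale_def by (intro coeffs_in_concat_mult coeffs_in_single)

lemma coeffs_in_rot: "coeffs_in S f \<Longrightarrow> coeffs_in S (rot f)"
  unfolding rot_def
  by (intro coeffs_in_extend) (auto intro!: coeffs_in_single signed simp: coeffs_in_def[of S f])

lemma coeffs_in_rot_power: "coeffs_in S f \<Longrightarrow> coeffs_in S ((rot ^^ i) f)"
  by (induction i) (auto intro: coeffs_in_rot)

lemma coeffs_in_cyc_mult:
  assumes "coeffs_in S f" "coeffs_in S g"
  shows "coeffs_in S (cyc_mult f g)"
proof -
  have [intro]: "Poly_Mapping.lookup f u \<in> S" "Poly_Mapping.lookup g u \<in> S" for u
    using assms by (auto simp: coeffs_in_def)
  show ?thesis
    unfolding cyc_mult_def
    by (intro coeffs_in_extend)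
      (auto intro!: coeffs_in_single mult coeffs_in_scale const coeffs_in_sum
        coeffs_in_concat_mult coeffs_in_rot_power)
qed

lemma coeffs_in_Sum_any:
  "(\<And>i. coeffs_in S (F i)) \<Longrightarrow> coeffs_in S (Sum_any F)"
  by (simp add: Sum_any.expand_set coeffs_in_sum)

end

locale copies_coefficient_ring = coefficient_ring S for S :: "((nat \<Rightarrow> 'p) \<Rightarrow> real) set"
begin

lemma coeffs_in_no_derivs: "coeffs_in S f \<Longrightarrow> coeffs_in S (no_derivs f)"
  unfolding no_derivs_def by (intro coeffs_in_extend coeffs_in_single) (simp add: coeffs_in_def)

lemma coeffs_in_defer_deriv: "coeffs_in S f \<Longrightarrow> coeffs_in S (defer_deriv \<alpha> \<sigma> f)"
  unfolding defer_deriv_def by (intro coeffs_in_extend_pair coeffs_in_single)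

lemma coeffs_in_partial: "coeffs_in S f \<Longrightarrow> coeffs_in S (partial l f)"
  unfolding partial_def by (intro coeffs_in_extend_pair coeffs_in_sum coeffs_in_single signed)

lemma coeffs_in_laplacian_part: "coeffs_in S f \<Longrightarrow> coeffs_in S (laplacian_part \<alpha> \<beta> f)"
  unfolding laplacian_part_def case_prod_unfold
  by (intro coeffs_in_sum coeffs_in_Sum_any coeffs_in_defer_deriv coeffs_in_partial)

end

section \<open>Smooth functions on several copies of a chart\<close>

text \<open>
  Derivatives of arbitrary functions are not additive, so additivity of total derivatives
  can be expected only on words with smooth coefficients and at points of the chart.
\<close>

definition pd_copy ::
  "('p, 'n::finite) chart \<Rightarrow> nat \<Rightarrow> 'n \<Rightarrow> ((nat \<Rightarrow> 'p) \<Rightarrow> real) \<Rightarrow> (nat \<Rightarrow> 'p) \<Rightarrow> real" where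
  "pd_copy \<phi> \<alpha> k c X = pd \<phi> k (\<lambda>q. c (X(\<alpha> := q))) (X \<alpha>)"

definition coordinate_shift :: "('p, 'n::finite) chart \<Rightarrow> 'n \<Rightarrow> real \<Rightarrow> 'p \<Rightarrow> 'p" where
  "coordinate_shift \<phi> k t p = inv_into (fst \<phi>) (snd \<phi>) (snd \<phi> p + t *\<^sub>R axis k 1)"

lemma pd_copy_eq:
  "pd_copy \<phi> \<alpha> k c X = deriv (\<lambda>t. c (X(\<alpha> := coordinate_shift \<phi> k t (X \<alpha>)))) 0"
  by (simp add: pd_copy_def pd_def coordinate_shift_def)

definition in_chart :: "('p, 'n) chart \<Rightarrow> (nat \<Rightarrow> 'p) \<Rightarrow> bool" where
  "in_chart \<phi> X \<longleftrightarrow> (\<forall>\<alpha>. X \<alpha> \<in> fst \<phi>)"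

text \<open>
  Only derivatives along coordinate lines over one copy at a time ever occur, so differentiability is
  required in these directions alone. The recursion on the order makes closure under products an
  induction by the Leibniz rule.
\<close>

fun differentiable_upto ::
  "('p, 'n::finite) chart \<Rightarrow> nat \<Rightarrow> ((nat \<Rightarrow> 'p) \<Rightarrow> real) \<Rightarrow> bool" where
  "differentiable_upto \<phi> 0 c \<longleftrightarrow> True"
| "differentiable_upto \<phi> (Suc n) c \<longleftrightarrow>
     (\<forall>X \<alpha> k. in_chart \<phi> X \<longrightarrow>
        (\<lambda>t. c (X(\<alpha> := coordinate_shift \<phi> k t (X \<alpha>)))) field_differentiable at 0) \<and>
     (\<forall>\<alpha> k. differentiable_upto \<phi> n (pd_copy \<phi> \<alpha> k c))"

definition smooth_coeffs :: "('p, 'n::finite) chart \<Rightarrow> ((nat \<Rightarrow> 'p) \<Rightarrow> real) set" where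
  "smooth_coeffs \<phi> = {c. \<forall>n. differentiable_upto \<phi> n c}"

lemma differentiable_upto_Suc: "differentiable_upto \<phi> (Suc n) c \<Longrightarrow> differentiable_upto \<phi> n c"
  by (induction n arbitrary: c) auto

text \<open>
  The image of a chart is open, so a coordinate line through a point stays in the chart for a short
  time, and derivatives at points of the chart only depend on values there.
\<close>

locale open_chart =
  fixes \<phi> :: "('p, 'n::{finite, linorder}) chart"
  assumes inj: "inj_on (snd \<phi>) (fst \<phi>)" and open_image: "open (snd \<phi> ` fst \<phi>)"
begin

lemma coordinate_shift_0: "p \<in> fst \<phi> \<Longrightarrow> coordinate_shift \<phi> k 0 p = p"
  by (simp add: coordinate_shift_def inj)

lemma eventually_shift_in_image:
  assumes "p \<in> fst \<phi>"
  shows "\<forall>\<^sub>F t in nhds 0. snd \<phi> p + t *\<^sub>R axis k 1 \<in> snd \<phi> ` fst \<phi>"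
proof -
  have "open ((\<lambda>t. snd \<phi> p + t *\<^sub>R axis k 1) -` (snd \<phi> ` fst \<phi>))"
    by (intro open_vimage open_image continuous_intros)
  then show ?thesis
    using assms unfolding eventually_nhds by (intro exI conjI) auto
qed

lemma eventually_in_chart:
  assumes "in_chart \<phi> X"
  shows "\<forall>\<^sub>F t in nhds 0. in_chart \<phi> (X(\<alpha> := coordinate_shift \<phi> k t (X \<alpha>)))"
proof -
  have "X \<alpha> \<in> fst \<phi>"
    using assms by (simp add: in_chart_def)
  from eventually_shift_in_image[OF this, of k] show ?thesis
    by eventually_elim
      (use assms in \<open>auto simp: in_chart_def coordinate_shift_def intro: inv_into_into\<close>)
qed

lemma eventually_slice_eq:
  assumes "\<And>X. in_chart \<phi> X \<Longrightarrow> c X = c' X" "in_chart \<phi> X"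
  shows "\<forall>\<^sub>F t in nhds 0. c (X(\<alpha> := coordinate_shift \<phi> k t (X \<alpha>)))
      = c' (X(\<alpha> := coordinate_shift \<phi> k t (X \<alpha>)))"
  by (rule eventually_mono[OF eventually_in_chart[OF assms(2)]]) (rule assms(1))

lemma pd_copy_cong:
  assumes "\<And>X. in_chart \<phi> X \<Longrightarrow> c X = c' X" "in_chart \<phi> X"
  shows "pd_copy \<phi> \<alpha> k c X = pd_copy \<phi> \<alpha> k c' X"
  unfolding pd_copy_eq
  by (rule deriv_cong_ev[OF eventually_slice_eq[OF assms] refl])

lemma field_differentiable_cong_ev:
  fixes f g :: "real \<Rightarrow> real"
  assumes "\<forall>\<^sub>F t in nhds x. f t = g t"
  shows "f field_differentiable at x \<longleftrightarrow> g field_differentiable at x"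
  unfolding field_differentiable_def using DERIV_cong_ev[OF refl assms refl] by blast

lemma differentiable_upto_cong:
  assumes "\<And>X. in_chart \<phi> X \<Longrightarrow> c X = c' X"
  shows "differentiable_upto \<phi> n c \<longleftrightarrow> differentiable_upto \<phi> n c'"
  using assms
proof (induction n arbitrary: c c')
  case (Suc n)
  have "(\<lambda>t. c (X(\<alpha> := coordinate_shift \<phi> k t (X \<alpha>)))) field_differentiable at 0 \<longleftrightarrow>
        (\<lambda>t. c' (X(\<alpha> := coordinate_shift \<phi> k t (X \<alpha>)))) field_differentiable at 0"
    if "in_chart \<phi> X" for X \<alpha> k
    by (rule field_differentiable_cong_ev[OF eventually_slice_eq[OF Suc.prems that]])
  moreover have "differentiable_upto \<phi> n (pd_copy \<phi> \<alpha> k c) \<longleftrightarrow>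
      differentiable_upto \<phi> n (pd_copy \<phi> \<alpha> k c')" for \<alpha> k
    by (intro Suc.IH pd_copy_cong Suc.prems)
  ultimately show ?case
    by simp
qed simp

lemma pd_copy_const: "pd_copy \<phi> \<alpha> k (\<lambda>_. r) = (\<lambda>_. 0)"
  by (simp add: pd_copy_eq fun_eq_iff)

lemma pd_copy_add:
  assumes "differentiable_upto \<phi> (Suc n) c" "differentiable_upto \<phi> (Suc m) c'" "in_chart \<phi> X"
  shows "pd_copy \<phi> \<alpha> k (c + c') X = (pd_copy \<phi> \<alpha> k c + pd_copy \<phi> \<alpha> k c') X"
  using assms by (simp add: pd_copy_eq)

lemma pd_copy_mult:
  assumes "differentiable_upto \<phi> (Suc n) c" "differentiable_upto \<phi> (Suc m) c'" "in_chart \<phi> X"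
  shows "pd_copy \<phi> \<alpha> k (c * c') X = (c * pd_copy \<phi> \<alpha> k c' + pd_copy \<phi> \<alpha> k c * c') X"
proof -
  have "X(\<alpha> := coordinate_shift \<phi> k 0 (X \<alpha>)) = X"
    using assms(3) by (simp add: coordinate_shift_0 in_chart_def)
  with assms show ?thesis
    by (simp add: pd_copy_eq)
qed

lemma differentiable_upto_const: "differentiable_upto \<phi> n (\<lambda>_. r)"
  by (induction n arbitrary: r) (simp_all add: pd_copy_const)

lemma differentiable_upto_add:
  "differentiable_upto \<phi> n c \<Longrightarrow> differentiable_upto \<phi> n c' \<Longrightarrow> differentiable_upto \<phi> n (c + c')"
proof (induction n arbitrary: c c')
  case (Suc n)
  have "differentiable_upto \<phi> n (pd_copy \<phi> \<alpha> k c + pd_copy \<phi> \<alpha> k c')" for \<alpha> k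
    using Suc.prems by (intro Suc.IH) auto
  then have "differentiable_upto \<phi> n (pd_copy \<phi> \<alpha> k (c + c'))" for \<alpha> k
    by (subst differentiable_upto_cong[OF pd_copy_add[OF Suc.prems]])
  moreover have "(\<lambda>t. (c + c') (X(\<alpha> := coordinate_shift \<phi> k t (X \<alpha>)))) field_differentiable at 0"
    if "in_chart \<phi> X" for X \<alpha> k
    using Suc.prems that unfolding plus_fun_apply by (intro field_differentiable_add) auto
  ultimately show ?case
    unfolding differentiable_upto.simps by blast
qed simp

lemma differentiable_upto_mult:
  "differentiable_upto \<phi> n c \<Longrightarrow> differentiable_upto \<phi> n c' \<Longrightarrow> differentiable_upto \<phi> n (c * c')"
proof (induction n arbitrary: c c')
  case (Suc n)
  \<comment> \<open>The Leibniz rule needs \<open>c\<close> and \<open>c'\<close> themselves only to the lower order \<open>n\<close>.\<close>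
  have "differentiable_upto \<phi> n (c * pd_copy \<phi> \<alpha> k c' + pd_copy \<phi> \<alpha> k c * c')" for \<alpha> k
    using Suc.prems differentiable_upto_Suc[OF Suc.prems(1)] differentiable_upto_Suc[OF Suc.prems(2)]
    by (intro differentiable_upto_add Suc.IH) auto
  then have "differentiable_upto \<phi> n (pd_copy \<phi> \<alpha> k (c * c'))" for \<alpha> k
    by (subst differentiable_upto_cong[OF pd_copy_mult[OF Suc.prems]])
  moreover have "(\<lambda>t. (c * c') (X(\<alpha> := coordinate_shift \<phi> k t (X \<alpha>)))) field_differentiable at 0"
    if "in_chart \<phi> X" for X \<alpha> k
    using Suc.prems that unfolding times_fun_apply by (intro field_differentiable_mult) auto
  ultimately show ?case
    unfolding differentiable_upto.simps by blast
qed simp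

lemma smooth_pd:
  assumes "smooth \<phi> c"
  shows "smooth \<phi> (pd \<phi> k c)"
  unfolding smooth_def
proof
  fix ks
  show "(\<lambda>z. foldr (pd \<phi>) ks (pd \<phi> k c) (inv_into (fst \<phi>) (snd \<phi>) z))
      differentiable_on snd \<phi> ` fst \<phi>"
    using assms[unfolded smooth_def, rule_format, of "ks @ [k]"] by simp
qed

text \<open>
  Coefficients of a single density, viewed over the copy \<open>\<beta>\<close>: derivatives over other copies vanish.
\<close>

lemma differentiable_upto_lift:
  "smooth \<phi> c \<Longrightarrow> differentiable_upto \<phi> n (\<lambda>X. c (X \<beta>))"
proof (induction n arbitrary: c)
  case (Suc n)
  have "(\<lambda>t. c (coordinate_shift \<phi> k t p)) field_differentiable at 0"
    if "p \<in> fst \<phi>" for p k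
  proof -
    let ?line = "\<lambda>t. snd \<phi> p + t *\<^sub>R axis k 1"
    have "(\<lambda>z. c (inv_into (fst \<phi>) (snd \<phi>) z)) differentiable_on snd \<phi> ` fst \<phi>"
      using Suc.prems[unfolded smooth_def, rule_format, of "[]"] by simp
    then have "(\<lambda>z. c (inv_into (fst \<phi>) (snd \<phi>) z)) differentiable at (?line 0)"
      using that open_image by (auto simp: differentiable_on_eq_differentiable_at)
    moreover have "?line differentiable at 0"
      unfolding differentiable_def
      by (rule exI[of _ "\<lambda>t. t *\<^sub>R axis k 1"]) (auto intro!: derivative_eq_intros)
    ultimately have "((\<lambda>z. c (inv_into (fst \<phi>) (snd \<phi>) z)) \<circ> ?line) differentiable at 0"
      by (intro differentiable_chain_at)
    then show ?thesis
      by (simp add: o_def coordinate_shift_def field_differentiable_def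
          real_differentiable_def)
  qed
  then have "(\<lambda>t. c ((X(\<alpha> := coordinate_shift \<phi> k t (X \<alpha>))) \<beta>)) field_differentiable at 0"
    if "in_chart \<phi> X" for X \<alpha> k
    using that by (cases "\<alpha> = \<beta>") (auto simp: in_chart_def)
  moreover have "pd_copy \<phi> \<alpha> k (\<lambda>X. c (X \<beta>)) = (if \<alpha> = \<beta> then (\<lambda>X. pd \<phi> k c (X \<beta>)) else (\<lambda>_. 0))"
    for \<alpha> k
    by (auto simp: fun_eq_iff pd_copy_def pd_def)
  ultimately show ?case
    using Suc.IH[OF smooth_pd[OF Suc.prems]] by (simp add: differentiable_upto_const)
qed simp

end

sublocale open_chart \<subseteq> copies_coefficient_ring "smooth_coeffs \<phi>"
  by unfold_locales (auto simp: smooth_coeffs_def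
    intro: differentiable_upto_const differentiable_upto_add differentiable_upto_mult)

section \<open>Additivity of total derivatives\<close>

lemma fun_sum_apply: "(\<Sum>i\<in>I. F i) x = (\<Sum>i\<in>I. F i x)"
  by (induction I rule: infinite_finite_induct) auto

lemma when_apply: "((c :: 'a \<Rightarrow> real) when P) x = (c x when P)"
  by (simp add: when_def)

lemma lookup_total_deriv:
  assumes "dc 0 = 0" "finite K" "Poly_Mapping.keys f \<subseteq> K"
  shows "Poly_Mapping.lookup (total_deriv dc \<alpha> k f) v = dc (Poly_Mapping.lookup f v) +
    (\<Sum>u\<in>K. \<Sum>j | j < length u \<and> copy (u ! j) = \<alpha>.
       Poly_Mapping.lookup f u when u[j := raise k (u ! j)] = v)"
proof -
  have "(\<Sum>u\<in>K. Poly_Mapping.lookup (Poly_Mapping.single u (dc (Poly_Mapping.lookup f u))) v)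
      = dc (Poly_Mapping.lookup f v)"
  proof (cases "v \<in> K")
    case False
    then have "Poly_Mapping.lookup f v = 0"
      using assms(3) by (meson in_keys_iff subsetD)
    with assms(1,2) False show ?thesis
      by (auto simp: lookup_single when_def)
  qed (use assms(2) in \<open>simp add: lookup_single when_def\<close>)
  moreover have "total_deriv dc \<alpha> k f = (\<Sum>u\<in>K. Poly_Mapping.single u (dc (Poly_Mapping.lookup f u)) +
      (\<Sum>j | j < length u \<and> copy (u ! j) = \<alpha>.
         Poly_Mapping.single (u[j := raise k (u ! j)]) (Poly_Mapping.lookup f u)))"
    unfolding total_deriv_def using assms by (intro extend_superset) auto
  ultimately show ?thesis
    by (simp add: lookup_sum lookup_add sum.distrib lookup_single)
qed

context open_chart
begin

abbreviation is_smooth :: "('a \<Rightarrow>\<^sub>0 ((nat \<Rightarrow> 'p) \<Rightarrow> real)) \<Rightarrow> bool" where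
  "is_smooth \<equiv> coeffs_in (smooth_coeffs \<phi>)"

text \<open>
  Additivity has to be formulated as a relation, because \<open>f = g + h\<close> turns under a total derivative
  into an equality of coefficients at the points of the chart only.
\<close>

definition is_sum_over_chart ::
  "('a \<Rightarrow>\<^sub>0 ((nat \<Rightarrow> 'p) \<Rightarrow> real)) \<Rightarrow> ('a \<Rightarrow>\<^sub>0 ((nat \<Rightarrow> 'p) \<Rightarrow> real))
    \<Rightarrow> ('a \<Rightarrow>\<^sub>0 ((nat \<Rightarrow> 'p) \<Rightarrow> real)) \<Rightarrow> bool" where
  "is_sum_over_chart f g h \<longleftrightarrow> (\<forall>u X. in_chart \<phi> X \<longrightarrow>
     Poly_Mapping.lookup f u X = Poly_Mapping.lookup g u X + Poly_Mapping.lookup h u X)"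

definition preserves_sums ::
  "(('a \<Rightarrow>\<^sub>0 ((nat \<Rightarrow> 'p) \<Rightarrow> real)) \<Rightarrow> ('b \<Rightarrow>\<^sub>0 ((nat \<Rightarrow> 'p) \<Rightarrow> real))) \<Rightarrow> bool" where
  "preserves_sums M \<longleftrightarrow> (\<forall>f. is_smooth f \<longrightarrow> is_smooth (M f)) \<and>
     (\<forall>f g h. is_smooth f \<longrightarrow> is_smooth g \<longrightarrow> is_smooth h \<longrightarrow>
        is_sum_over_chart f g h \<longrightarrow> is_sum_over_chart (M f) (M g) (M h))"

lemma smooth_coeffs_pd_copy: "c \<in> smooth_coeffs \<phi> \<Longrightarrow> pd_copy \<phi> \<alpha> k c \<in> smooth_coeffs \<phi>"
  unfolding smooth_coeffs_def using differentiable_upto.simps(2) by blast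

lemma pd_copy_zero: "pd_copy \<phi> \<alpha> k 0 = 0"
  using pd_copy_const[of \<alpha> k 0] by (simp add: func_zero)

lemma total_deriv_copy_eq: "total_deriv_copy \<phi> \<alpha> k = total_deriv (pd_copy \<phi> \<alpha> k) \<alpha> k"
  by (simp add: total_deriv_copy_def pd_copy_def[abs_def])

lemma preserves_sums_total_deriv_copy: "preserves_sums (total_deriv_copy \<phi> \<alpha> k)"
  unfolding preserves_sums_def
proof (intro conjI allI impI)
  fix f :: "('p, 'm, 'n) pwords"
  assume "is_smooth f"
  then have "Poly_Mapping.lookup f u \<in> smooth_coeffs \<phi>" for u
    by (simp add: coeffs_in_def)
  then show "is_smooth (total_deriv_copy \<phi> \<alpha> k f)"
    unfolding total_deriv_copy_eq total_deriv_def
    by (intro coeffs_in_extend coeffs_in_add coeffs_in_single coeffs_in_sum smooth_coeffs_pd_copy)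
next
  fix f g h :: "('p, 'm, 'n) pwords"
  assume smooth: "is_smooth f" "is_smooth g" "is_smooth h" and sum: "is_sum_over_chart f g h"
  let ?l = Poly_Mapping.lookup
  let ?K = "Poly_Mapping.keys f \<union> Poly_Mapping.keys g \<union> Poly_Mapping.keys h"
  have *: "?l (total_deriv_copy \<phi> \<alpha> k r) v X = pd_copy \<phi> \<alpha> k (?l r v) X +
      (\<Sum>u\<in>?K. \<Sum>j | j < length u \<and> copy (u ! j) = \<alpha>. ?l r u X when u[j := raise k (u ! j)] = v)"
    if "Poly_Mapping.keys r \<subseteq> ?K" for r v X
    unfolding total_deriv_copy_eq
    by (subst lookup_total_deriv[where dc = "pd_copy \<phi> \<alpha> k", OF pd_copy_zero _ that]) (simp_all add: fun_sum_apply when_apply)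
  have "?l (total_deriv_copy \<phi> \<alpha> k f) v X
      = ?l (total_deriv_copy \<phi> \<alpha> k g) v X + ?l (total_deriv_copy \<phi> \<alpha> k h) v X"
    if X: "in_chart \<phi> X" for v X
  proof -
    have "pd_copy \<phi> \<alpha> k (?l f v) X = pd_copy \<phi> \<alpha> k (?l g v + ?l h v) X"
      by (rule pd_copy_cong[OF _ X]) (use sum in \<open>simp add: is_sum_over_chart_def\<close>)
    also have "\<dots> = (pd_copy \<phi> \<alpha> k (?l g v) + pd_copy \<phi> \<alpha> k (?l h v)) X"
      using smooth by (intro pd_copy_add[of 0 _ 0] X) (auto simp: coeffs_in_def smooth_coeffs_def simp del: differentiable_upto.simps)
    finally have pd: "pd_copy \<phi> \<alpha> k (?l f v) X
        = pd_copy \<phi> \<alpha> k (?l g v) X + pd_copy \<phi> \<alpha> k (?l h v) X"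
      by simp
    have l: "(?l f u X when P) = (?l g u X when P) + (?l h u X when P)" for u P
      using sum X by (simp add: is_sum_over_chart_def when_def)
    show ?thesis
      by (subst (1 2 3) *) (auto simp: pd l sum.distrib)
  qed
  then show "is_sum_over_chart (total_deriv_copy \<phi> \<alpha> k f)
      (total_deriv_copy \<phi> \<alpha> k g) (total_deriv_copy \<phi> \<alpha> k h)"
    by (simp add: is_sum_over_chart_def)
qed

lemma preserves_sumsD:
  "preserves_sums M \<Longrightarrow> is_sum_over_chart f g h \<Longrightarrow> is_smooth f \<Longrightarrow> is_smooth g \<Longrightarrow> is_smooth h
    \<Longrightarrow> is_sum_over_chart (M f) (M g) (M h)"
  by (simp add: preserves_sums_def)

lemma preserves_sums_signed: "preserves_sums (signed k)"
  unfolding preserves_sums_def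
  by (auto simp: coeffs_in_signed) (auto simp: is_sum_over_chart_def signed_def)

lemma preserves_sums_comp:
  "preserves_sums M \<Longrightarrow> preserves_sums N \<Longrightarrow> preserves_sums (\<lambda>f. M (N f))"
  by (simp add: preserves_sums_def)

lemma preserves_sums_foldr:
  "(\<And>a. preserves_sums (M a)) \<Longrightarrow> preserves_sums (foldr M xs)"
  by (induction xs) (simp_all add: preserves_sums_def)

lemma preserves_sums_minus_total_deriv: "preserves_sums (minus_total_deriv \<phi> \<alpha> \<sigma>)"
  unfolding minus_total_deriv_def[abs_def]
  by (rule preserves_sums_comp[OF preserves_sums_signed
        preserves_sums_foldr[OF preserves_sums_total_deriv_copy]])

lemma minus_total_deriv_zero: "minus_total_deriv \<phi> \<alpha> \<sigma> 0 = (0 :: ('p, 'm, 'n) pwords)"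
proof -
  have "foldr (total_deriv_copy \<phi> \<alpha>) ks 0 = (0 :: ('p, 'm, 'n) pwords)" for ks
    by (induction ks) (simp_all add: total_deriv_copy_eq total_deriv_def)
  then show ?thesis
    by (simp add: minus_total_deriv_def)
qed

text \<open>
  Identities between deferred expressions therefore survive the final performance of the total
  derivatives, provided that all coefficients are smooth.
\<close>

lemma lookup_perform_derivs_add:
  fixes f g :: "('p, 'm, 'n) deferred"
  assumes "is_smooth f" "is_smooth g" "in_chart \<phi> X"
  shows "Poly_Mapping.lookup (perform_derivs \<phi> \<alpha>s (f + g)) v X =
    Poly_Mapping.lookup (perform_derivs \<phi> \<alpha>s f) v X +
    Poly_Mapping.lookup (perform_derivs \<phi> \<alpha>s g) v X"
proof -
  let ?l = Poly_Mapping.lookup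
  define T where "T = (\<lambda>(P, u :: (nat, 'm, 'n) word) c. foldr (\<lambda>\<alpha>. minus_total_deriv \<phi> \<alpha> (P \<alpha>)) \<alpha>s (Poly_Mapping.single u c))"
  \<comment> \<open>A key may be missing from one of the summands; there its coefficient is \<open>0\<close>.\<close>
  have T0: "T k 0 = 0" for k
  proof -
    have "foldr (\<lambda>\<alpha>. minus_total_deriv \<phi> \<alpha> (P \<alpha>)) \<alpha>s 0 = 0" for P
      by (induction \<alpha>s) (simp_all add: minus_total_deriv_zero)
    then show ?thesis
      by (cases k) (simp add: T_def)
  qed
  have T_add: "?l (T k (c + c')) v X = ?l (T k c) v X + ?l (T k c') v X"
    if "c \<in> smooth_coeffs \<phi>" "c' \<in> smooth_coeffs \<phi>" for k c c'
  proof (cases k)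
    case (Pair P u)
    have "is_sum_over_chart (Poly_Mapping.single u (c + c'))
        (Poly_Mapping.single u c) (Poly_Mapping.single u c')"
      by (simp add: is_sum_over_chart_def single_add lookup_add)
    then have "is_sum_over_chart (T k (c + c')) (T k c) (T k c')"
      unfolding Pair T_def prod.case
      by (rule preserves_sumsD[OF preserves_sums_foldr[OF preserves_sums_minus_total_deriv]])
        (intro coeffs_in_single add that)+
    then show ?thesis
      using assms(3) by (simp add: is_sum_over_chart_def)
  qed
  let ?K = "Poly_Mapping.keys f \<union> Poly_Mapping.keys g"
  have *: "?l (perform_derivs \<phi> \<alpha>s r) v X = (\<Sum>k\<in>?K. ?l (T k (?l r k)) v X)"
    if "Poly_Mapping.keys r \<subseteq> ?K" for r
    unfolding perform_derivs_def T_def[symmetric]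
    by (subst extend_superset[where T = T, OF _ that T0]) (simp_all add: lookup_sum fun_sum_apply)
  have smooth: "?l f k \<in> smooth_coeffs \<phi>" "?l g k \<in> smooth_coeffs \<phi>" for k
    using assms(1,2) unfolding coeffs_in_def by blast+
  show ?thesis
    by (simp add: *[OF Poly_Mapping.keys_add] *[OF Un_upper1] *[OF Un_upper2]
      lookup_add T_add[OF smooth] sum.distrib)
qed

lemma lookup_diagonal:
  fixes r :: "('p, 'm, 'n) pwords"
  assumes "finite K" "Poly_Mapping.keys r \<subseteq> K"
  shows "Poly_Mapping.lookup (diagonal r) u p =
    (\<Sum>v\<in>K. Poly_Mapping.lookup r v (\<lambda>_. p) when map (map_letter (\<lambda>_. ()) id id) v = u)"
proof -
  have "diagonal r = (\<Sum>v\<in>K. Poly_Mapping.single (map (map_letter (\<lambda>_. ()) id id) v)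
      (\<lambda>p. Poly_Mapping.lookup r v (\<lambda>_. p)))"
    unfolding diagonal_def
    by (rule extend_superset[OF assms]) (simp add: zero_fun_def flip: func_zero)
  then show ?thesis
    by (simp add: lookup_sum lookup_single fun_sum_apply when_apply)
qed

definition evaluate ::
  "nat list \<Rightarrow> (unit, 'm, 'n) word \<Rightarrow> 'p \<Rightarrow> ('p, 'm, 'n) deferred \<Rightarrow> real" where
  "evaluate \<alpha>s u p z = Poly_Mapping.lookup (diagonal (perform_derivs \<phi> \<alpha>s z)) u p"

lemma evaluate_add:
  assumes "p \<in> fst \<phi>" "is_smooth f" "is_smooth g"
  shows "evaluate \<alpha>s u p (f + g) = evaluate \<alpha>s u p f + evaluate \<alpha>s u p g"
proof -
  let ?P = "perform_derivs \<phi> \<alpha>s"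
  let ?K = "Poly_Mapping.keys (?P (f + g)) \<union> Poly_Mapping.keys (?P f) \<union> Poly_Mapping.keys (?P g)"
  let ?D = "\<lambda>r. \<Sum>v\<in>?K. Poly_Mapping.lookup (?P r) v (\<lambda>_. p) when map (map_letter (\<lambda>_. ()) id id) v = u"
  have "evaluate \<alpha>s u p r = ?D r" if "r \<in> {f + g, f, g}" for r
    unfolding evaluate_def using that by (intro lookup_diagonal) auto
  moreover have "in_chart \<phi> (\<lambda>_. p)"
    using assms(1) by (simp add: in_chart_def)
  note lookup_perform_derivs_add[OF assms(2,3) this]
  ultimately show ?thesis
    by (simp add: when_add_distrib sum.distrib)
qed

lemma evaluate_zero:
  assumes "p \<in> fst \<phi>"
  shows "evaluate \<alpha>s u p 0 = 0"
  using evaluate_add[OF assms coeffs_in_zero coeffs_in_zero, of \<alpha>s u] by simp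

lemma evaluate_signed:
  assumes "p \<in> fst \<phi>" "is_smooth f"
  shows "evaluate \<alpha>s u p (signed k f) = signed k (evaluate \<alpha>s u p f)"
proof -
  have "is_smooth (- f)"
    using coeffs_in_signed[OF assms(2), of 1] by (simp add: signed_def)
  from evaluate_add[OF assms this, of \<alpha>s u] evaluate_zero[OF assms(1), of \<alpha>s u] show ?thesis
    by (simp add: signed_def)
qed

lemma is_smooth_tag:
  assumes "smooth_words \<phi> f"
  shows "is_smooth (tag \<alpha> f)"
  unfolding tag_def
proof (intro coeffs_in_extend coeffs_in_single)
  show "(\<lambda>X. Poly_Mapping.lookup f u (X \<alpha>)) \<in> smooth_coeffs \<phi>" for u
    using assms by (auto simp: smooth_coeffs_def smooth_words_def intro: differentiable_upto_lift)
qed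

end

section \<open>Iterated brackets\<close>

text \<open>
  Up to sign the bracket of two factors: one deleted letter comes from each of them.
\<close>

definition pairing ::
  "nat \<Rightarrow> nat \<Rightarrow> ('p, 'm::finite, 'n) deferred \<Rightarrow> ('p, 'm, 'n) deferred" where
  "pairing \<alpha> \<beta> z = laplacian_part \<alpha> \<beta> z + laplacian_part \<beta> \<alpha> z"

lemma pairing_commute: "pairing \<alpha> \<beta> z = pairing \<beta> \<alpha> z"
  by (simp add: pairing_def add.commute)

lemma additive_pairing: "additive_map (pairing \<alpha> \<beta>)"
  by (simp add: pairing_def[abs_def] additive_plus additive_laplacian_part)

text \<open>
  The case \<open>{\<alpha>, \<beta>} = {\<gamma>, \<delta>}\<close> says that a pairing squares to zero.
\<close>

lemma pairing_anticommute: "pairing \<alpha> \<beta> (pairing \<gamma> \<delta> z) = - pairing \<gamma> \<delta> (pairing \<alpha> \<beta> z)"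
proof -
  note l = laplacian_part_anticommute
  show ?thesis
    by (simp add: pairing_def additive.add[OF additive_laplacian_part]
      l[of \<alpha> \<beta> \<gamma> \<delta>] l[of \<alpha> \<beta> \<delta> \<gamma>] l[of \<beta> \<alpha> \<gamma> \<delta>] l[of \<beta> \<alpha> \<delta> \<gamma>])
qed

lemma laplacian_cross_terms_pairing:
  assumes "finite S" "finite T" "S \<inter> T = {}"
  shows "laplacian (S \<union> T) z - laplacian S z - laplacian T z
    = (\<Sum>\<alpha>\<in>S. \<Sum>\<beta>\<in>T. pairing \<alpha> \<beta> z)"
  unfolding pairing_def by (rule laplacian_cross_terms[OF assms])

text \<open>
  The bracket of composites pairs each factor of \<open>X\<close> with each factor of \<open>Y\<close>: the terms of the
  Laplacian internal to \<open>X\<close> or to \<open>Y\<close> cancel. In the exponent, the grading of \<open>X\<close> occurs once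
  from the definition of the bracket, and once for each odd operator inside \<open>Y\<close> that passes over \<open>X\<close>.
\<close>

lemma act_Bracket:
  assumes "set (factors X) \<inter> set (factors Y) = {}"
  shows "act d (Bracket X Y) z = signed (grading d X * (1 + int (brackets Y)))
    (\<Sum>\<alpha>\<in>set (factors X). \<Sum>\<beta>\<in>set (factors Y). pairing \<alpha> \<beta> (act d Y (act d X z)))"
  unfolding act.simps Let_def
  by (subst laplacian_cross_terms_pairing[OF _ _ assms])
    (simp_all add: additive_apply_signed[OF additive_pairing]
      additive.sum[OF additive_signed] distrib_left)

lemma act_right_nested:
  fixes z :: "('p, 'm::finite, 'n) deferred"
  assumes "\<alpha> \<noteq> \<beta>" "\<beta> \<noteq> \<gamma>" "\<alpha> \<noteq> \<gamma>"
  shows "act d (Bracket (Factor \<alpha>) (Bracket (Factor \<beta>) (Factor \<gamma>))) z =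
    signed (int (d \<beta>)) (pairing \<alpha> \<beta> (pairing \<beta> \<gamma> z) + pairing \<alpha> \<gamma> (pairing \<beta> \<gamma> z))"
proof -
  \<comment> \<open>The sign of \<open>\<alpha>\<close> arises twice: from the outer bracket and from passing over \<open>\<alpha>\<close>.\<close>
  have [simp]: "signed (int (d \<alpha>) * 2 + int (d \<beta>)) w = signed (int (d \<beta>)) w"
    for w :: "('p, 'm, 'n) deferred"
    by (simp add: signed_def)
  show ?thesis
    using assms
    by (simp add: act_Bracket del: act.simps(2))
       (simp add: additive_apply_signed[OF additive_pairing] flip: additive.add[OF additive_signed])
qed

lemma act_left_nested:
  assumes "\<alpha> \<noteq> \<beta>" "\<beta> \<noteq> \<gamma>" "\<alpha> \<noteq> \<gamma>"
  shows "act d (Bracket (Bracket (Factor \<alpha>) (Factor \<beta>)) (Factor \<gamma>)) z =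
    - signed (int (d \<beta>)) (pairing \<alpha> \<gamma> (pairing \<alpha> \<beta> z) + pairing \<beta> \<gamma> (pairing \<alpha> \<beta> z))"
  using assms
  by (simp add: act_Bracket del: act.simps(2))
     (simp add: additive_apply_signed[OF additive_pairing] additive.minus[OF additive_pairing]
       signed_def)

text \<open>
  The inversions among three factors are among the pairs of positions \<open>(0, 1)\<close>, \<open>(0, 2)\<close>, \<open>(1, 2)\<close>.
\<close>

lemma koszul_three:
  "koszul d [\<alpha>, \<beta>, \<gamma>] = (if \<beta> < \<alpha> then int (d \<alpha> * d \<beta>) else 0)
    + (if \<gamma> < \<alpha> then int (d \<alpha> * d \<gamma>) else 0) + (if \<gamma> < \<beta> then int (d \<beta> * d \<gamma>) else 0)"
proof -
  let ?l = "[\<alpha>, \<beta>, \<gamma>]"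
  let ?g = "\<lambda>(i, j). if ?l ! j < ?l ! i then int (d (?l ! i) * d (?l ! j)) else 0"
  let ?P = "{(0, 1), (0, 2), (1, 2)} :: (nat \<times> nat) set"
  have "{(i, j). i < j \<and> j < length ?l \<and> ?l ! j < ?l ! i} = {x \<in> ?P. case x of (i, j) \<Rightarrow> ?l ! j < ?l ! i}"
    by (auto simp: less_Suc_eq numeral_2_eq_2)
  then have "koszul d ?l = (\<Sum>x\<in>?P. ?g x)"
    unfolding koszul_def by (simp only:) (subst sum.inter_filter, auto intro!: sum.cong)
  then show ?thesis
    by simp
qed

lemma (in copies_coefficient_ring) coeffs_in_pairing:
  "coeffs_in S z \<Longrightarrow> coeffs_in S (pairing \<alpha> \<beta> z)"
  unfolding pairing_def by (intro coeffs_in_add coeffs_in_laplacian_part)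

context open_chart
begin

lemma evaluate_act_right_nested:
  assumes "p \<in> fst \<phi>" "is_smooth z" "\<alpha> \<noteq> \<beta>" "\<beta> \<noteq> \<gamma>" "\<alpha> \<noteq> \<gamma>"
  shows "evaluate \<alpha>s u p (act d (Bracket (Factor \<alpha>) (Bracket (Factor \<beta>) (Factor \<gamma>))) (signed k z)) =
    signed (int (d \<beta>) + k) (evaluate \<alpha>s u p (pairing \<alpha> \<beta> (pairing \<beta> \<gamma> z))
      + evaluate \<alpha>s u p (pairing \<alpha> \<gamma> (pairing \<beta> \<gamma> z)))"
  unfolding act_right_nested[OF assms(3-5)]
  by (simp add: additive_apply_signed[OF additive_pairing] evaluate_signed evaluate_add assms(1,2)
    coeffs_in_add coeffs_in_pairing flip: additive.add[OF additive_signed])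

lemma evaluate_act_left_nested:
  assumes "p \<in> fst \<phi>" "is_smooth z" "\<alpha> \<noteq> \<beta>" "\<beta> \<noteq> \<gamma>" "\<alpha> \<noteq> \<gamma>"
  shows "evaluate \<alpha>s u p (act d (Bracket (Bracket (Factor \<alpha>) (Factor \<beta>)) (Factor \<gamma>)) (signed k z)) =
    signed (int (d \<beta>) + k + 1) (evaluate \<alpha>s u p (pairing \<alpha> \<gamma> (pairing \<alpha> \<beta> z))
      + evaluate \<alpha>s u p (pairing \<beta> \<gamma> (pairing \<alpha> \<beta> z)))"
proof -
  have "act d (Bracket (Bracket (Factor \<alpha>) (Factor \<beta>)) (Factor \<gamma>)) (signed k z) =
    signed (int (d \<beta>) + k + 1) (pairing \<alpha> \<gamma> (pairing \<alpha> \<beta> z) + pairing \<beta> \<gamma> (pairing \<alpha> \<beta> z))"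
    unfolding act_left_nested[OF assms(3-5)]
    by (simp add: additive_apply_signed[OF additive_pairing] flip: additive.add[OF additive_signed])
      (simp add: signed_def)
  then show ?thesis
    by (simp add: evaluate_signed evaluate_add assms(1,2) coeffs_in_add coeffs_in_pairing
      del: act.simps)
qed

end

section \<open>Equality of densities and of functionals\<close>

lemma lookup_at_point: "Poly_Mapping.lookup (at_point p f) u = Poly_Mapping.lookup f u p"
  by (cases "u \<in> Poly_Mapping.keys f")
    (simp_all add: at_point_def lookup_extend lookup_single when_def in_keys_iff zero_fun_apply)

lemma lookup_scale: "Poly_Mapping.lookup (scale c f) u = c * Poly_Mapping.lookup f u"
proof -
  have "scale c f = extend (\<lambda>v d. Poly_Mapping.single v (c * d)) f"
    unfolding scale_def concat_mult_def
    by (subst extend_single) (simp_all add: extend_def)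
  then show ?thesis
    by (cases "u \<in> Poly_Mapping.keys f") (simp_all add: lookup_extend lookup_single when_def in_keys_iff)
qed

lemma scale_zero: "scale c 0 = 0"
  by (rule poly_mapping_eqI) (simp add: lookup_scale)

lemma smooth_zero: "smooth \<phi> 0"
proof -
  have "foldr (pd \<phi>) ks 0 = 0" for ks
    by (induction ks) (auto simp: pd_def fun_eq_iff zero_fun_apply)
  then show ?thesis
    by (simp add: smooth_def zero_fun_apply)
qed

lemma cyc_eq_refl: "cyc_eq f f"
  unfolding cyc_eq_def by (rule exI[of _ 0]) (simp add: rot_def)

lemma at_point_zero: "at_point p 0 = 0"
  by (simp add: at_point_def)

lemma is_current_zero: "is_current \<A> (\<lambda>_ _. 0)"
  by (auto simp: is_current_def smooth_words_def smooth_zero zero_fun_apply change_coordinates_def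
    at_point_zero scale_zero cyc_eq_refl intro: exI[of _ "{}"])

text \<open>
  Densities with the same coefficients at the points of every chart define the same functional, the
  zero current being a witness.
\<close>

lemma same_functionalI:
  assumes "\<And>\<phi> p u. \<phi> \<in> \<A> \<Longrightarrow> p \<in> fst \<phi> \<Longrightarrow>
    Poly_Mapping.lookup (f \<phi>) u p = Poly_Mapping.lookup (g \<phi>) u p"
  shows "same_functional \<A> vol f g"
proof -
  have "at_point p (scale (vol \<phi>) (f \<phi> - g \<phi>)) =
      at_point p (\<Sum>k\<in>UNIV. total_deriv (pd \<phi> k) () k (scale (vol \<phi>) 0))"
    if "\<phi> \<in> \<A>" "p \<in> fst \<phi>" for \<phi> p
    by (rule poly_mapping_eqI)
      (simp add: lookup_at_point lookup_scale scale_zero total_deriv_def lookup_minus assms that)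
  then show ?thesis
    unfolding same_functional_def
    by (intro exI[of _ "\<lambda>_ _. 0"]) (simp add: is_current_zero cyc_eq_refl)
qed

lemma open_chart_atlas:
  assumes "oriented_affine_atlas \<A>" "\<phi> \<in> \<A>"
  shows "open_chart \<phi>"
proof
  have "open (snd \<phi> ` fst \<phi>) \<and>
      homeomorphism (fst \<phi>) (snd \<phi> ` fst \<phi>) (snd \<phi>) (inv_into (fst \<phi>) (snd \<phi>))"
    using assms unfolding oriented_affine_atlas_def by (auto simp: case_prod_unfold)
  then show "open (snd \<phi> ` fst \<phi>)" "inj_on (snd \<phi>) (fst \<phi>)"
    by (auto simp: homeomorphism_def intro: inj_on_inverseI)
qed

lemma lookup_signed_density:
  "Poly_Mapping.lookup ((signed k e :: ('p, 'm, 'n) density) \<phi>) u p = signed k (Poly_Mapping.lookup (e \<phi>) u p)"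
  by (simp add: signed_def)

section \<open>The Jacobi identity\<close>

theorem theorem12:
  fixes \<A> :: "('p::{t2_space, second_countable_topology}, 'n::{finite, linorder}) chart set"
    and vol :: "('p, 'n) chart \<Rightarrow> 'p \<Rightarrow> real"
    and f g h :: "('p, 'm::finite, 'n) density"
    and d :: "nat \<Rightarrow> nat"
  assumes "oriented_affine_atlas \<A>"
    and "volume_element \<A> vol"
    and "is_density \<A> f" "is_density \<A> g" "is_density \<A> h"
    and "homogeneous \<A> (d 0) f" "homogeneous \<A> (d 1) g" "homogeneous \<A> (d 2) h"
  shows
    "let F = Factor 0; G = Factor 1; H = Factor 2;
         dF = int (d 0) - 1; dG = int (d 1) - 1; dH = int (d 2) - 1;
         eval = bracket_density f g h d
     in
       same_functional \<A> vol
         (signed (dF * dH) (eval (Bracket F (Bracket G H))) +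
          signed (dF * dG) (eval (Bracket G (Bracket H F))) +
          signed (dG * dH) (eval (Bracket H (Bracket F G))))
         0 \<and>
       same_functional \<A> vol
         (eval (Bracket F (Bracket G H)))
         (eval (Bracket (Bracket F G) H) +
          signed (dF * dG) (eval (Bracket G (Bracket F H)))) \<and>
       same_functional \<A> vol
         (eval ((Bracket F \<circ> Bracket G) H) -
          signed (dF * dG) (eval ((Bracket G \<circ> Bracket F) H)))
         (eval (Bracket (Bracket F G) H))"
proof -
  let ?F = "Factor 0" and ?G = "Factor 1" and ?H = "Factor 2"
  let ?dF = "int (d 0) - 1" and ?dG = "int (d 1) - 1" and ?dH = "int (d 2) - 1"
  let ?eval = "bracket_density f g h d"
  let ?l = Poly_Mapping.lookup
  have main: "signed (?dF * ?dH) (?l (?eval (Bracket ?F (Bracket ?G ?H)) \<phi>) u p) +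
          signed (?dF * ?dG) (?l (?eval (Bracket ?G (Bracket ?H ?F)) \<phi>) u p) +
          signed (?dG * ?dH) (?l (?eval (Bracket ?H (Bracket ?F ?G)) \<phi>) u p) = 0 \<and>
      ?l (?eval (Bracket ?F (Bracket ?G ?H)) \<phi>) u p =
        ?l (?eval (Bracket (Bracket ?F ?G) ?H) \<phi>) u p
          + signed (?dF * ?dG) (?l (?eval (Bracket ?G (Bracket ?F ?H)) \<phi>) u p)"
    if "\<phi> \<in> \<A>" "p \<in> fst \<phi>" for \<phi> p u
  proof -
    interpret open_chart \<phi>
      using assms(1) that(1) by (rule open_chart_atlas)
    define w where "w = cyc_mult (cyc_mult (tag 0 (f \<phi>)) (tag 1 (g \<phi>))) (tag 2 (h \<phi>))"
    define z where "z = no_derivs w"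
    have "smooth_words \<phi> (f \<phi>)" "smooth_words \<phi> (g \<phi>)" "smooth_words \<phi> (h \<phi>)"
      using assms(3-5) that(1) by (auto simp: is_density_def)
    then have z: "is_smooth z"
      unfolding z_def w_def by (intro coeffs_in_no_derivs coeffs_in_cyc_mult is_smooth_tag)
    let ?e = "evaluate [0, 1, 2] u p"
    have eval: "?l (?eval X \<phi>) u p = ?e (act d X (signed (koszul d (factors X)) z))" for X
      by (simp add: bracket_density_def evaluate_def z_def w_def)
    \<comment> \<open>Up to sign, these three numbers are all compositions of two different pairings.\<close>
    define AB where "AB = ?e (pairing 0 1 (pairing 0 2 z))"
    define AC where "AC = ?e (pairing 0 1 (pairing 1 2 z))"
    define BC where "BC = ?e (pairing 0 2 (pairing 1 2 z))"
    have swap: "?e (- y) = - ?e y" if "is_smooth y" for y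
      using evaluate_signed[OF \<open>p \<in> fst \<phi>\<close> that, of _ _ 1] by (simp add: signed_def)
    have BA: "?e (pairing 0 2 (pairing 0 1 z)) = - AB"
      and CA: "?e (pairing 1 2 (pairing 0 1 z)) = - AC"
      and CB: "?e (pairing 1 2 (pairing 0 2 z)) = - BC"
      unfolding AB_def AC_def BC_def
      by ((subst pairing_anticommute,
          simp only: swap[OF coeffs_in_pairing[OF coeffs_in_pairing[OF z]]])+)
    note nested = evaluate_act_right_nested[OF \<open>p \<in> fst \<phi>\<close> z]
      evaluate_act_left_nested[OF \<open>p \<in> fst \<phi>\<close> z]
    have *: "pairing 1 0 = pairing 0 1" "pairing 2 0 = pairing 0 2" "pairing 2 1 = pairing 1 2"
      by (auto simp: pairing_commute fun_eq_iff)
    \<comment> \<open>In each exponent, the grading of the middle factor comes from the brackets and the products come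
      from the transpositions of factors; nesting on the left contributes the \<open>1\<close> in the shifted
      grading of the inner bracket.\<close>
    have "?l (?eval (Bracket ?F (Bracket ?G ?H)) \<phi>) u p = signed (int (d 1)) (AC + BC)"
      by (simp add: eval nested koszul_three AC_def BC_def del: act.simps One_nat_def)
    moreover have "?l (?eval (Bracket ?G (Bracket ?H ?F)) \<phi>) u p
        = signed (int (d 2 + d 1 * d 0 + d 2 * d 0)) (AB - BC)"
      by (simp add: eval nested koszul_three * CB AB_def[symmetric] add_ac del: act.simps One_nat_def)
    moreover have "?l (?eval (Bracket ?H (Bracket ?F ?G)) \<phi>) u p
        = signed (int (d 0 + d 2 * d 0 + d 2 * d 1)) (- AB - AC)"
      by (simp add: eval nested koszul_three * BA CA add_ac del: act.simps One_nat_def)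
    moreover have "?l (?eval (Bracket (Bracket ?F ?G) ?H) \<phi>) u p = signed (int (d 1 + 1)) (- AB - AC)"
      by (simp add: eval nested koszul_three * BA CA add_ac del: act.simps One_nat_def)
    moreover have "?l (?eval (Bracket ?G (Bracket ?F ?H)) \<phi>) u p
        = signed (int (d 0 + d 1 * d 0)) (AB - BC)"
      by (simp add: eval nested koszul_three * CB AB_def[symmetric] add_ac del: act.simps One_nat_def)
    \<comment> \<open>What remains is linear in these numbers, with signs given by the parities of the gradings.\<close>
    ultimately show ?thesis
      by (cases "even (d 0)"; cases "even (d 1)"; cases "even (d 2)") (simp_all add: signed_def)
  qed
  note jacobi = main[THEN conjunct1] and leibniz = main[THEN conjunct2]
  show ?thesis
    unfolding Let_def o_def
    by (intro conjI same_functionalI;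
        simp only: lookup_signed_density lookup_add lookup_minus lookup_zero
          plus_fun_apply minus_apply zero_fun_apply;
        ((rule jacobi; assumption) | simp only: leibniz add_diff_cancel_right'))
qed

end
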